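(* Let $\mathcal{E} = (\mathbf{R}, \mathbf{S}, \Sigma_{\mathrm{st}}, \mathcal{F}, F_{\mathrm{int}})$ be a fully-typed relational to RDF data exchange setting and let $I$ be a (finite) valid instance of $\mathbf{R}$. If the ShEx schema $\mathbf{S}$ is weakly-recursive, then every chase sequence of $I$ with $\Sigma_{\mathrm{st}}\cup\Sigma_{\mathbf{S}}$ is finite, and either every (maximal) chase sequence of $I$ with $\Sigma_{\mathrm{st}}\cup\Sigma_{\mathbf{S}}$ fails, or every such chase sequence computes a universal solution for $I$ w.r.t. $\mathcal{E}$.
   Context: **Domain.** $\mathbf{Dom}$ is a fixed countably infinite set partitioned into three infinite sets $\mathbf{Dom} = \mathbf{Iri}\cup\mathbf{Lit}\cup\mathbf{Blank}$ (IRIs, literals, blank nodes). $\mathbf{NullLit}\subseteq\mathbf{Lit}$ is an infinite subset of null literals, and $\mathbf{Null}=\mathbf{NullLit}\cup\mathbf{Blank}$ is the set of null values. **Source schema.** A relational schema is $\mathbf{R}=(\mathcal{R},\Sigma_{\mathrm{fd}})$ where $\mathcal{R}$ is a finite set of relation symbols with arities and $\Sigma_{\mathrm{fd}}$ is a set of functional dependencies $R:X\to Y$, with $R\in\mathcal{R}$ of arity $n$ and $X,Y\subseteq\{1,\dots,n\}$, with the usual meaning. Instances $I$ of $\mathbf{R}$ are finite and all their values are in $\mathbf{Lit}\setminus\mathbf{NullLit}$; $I$ is valid if $I\models\Sigma_{\mathrm{fd}}$. For a relational structure $K$, $\mathit{dom}(K)$ denotes the set of values occurring in its relations. **Target schema.**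 A ShEx schema is $\mathbf{S}=(\mathcal{T},\delta)$ where $\mathcal{T}$ is a finite set of shape names (types) and $\delta$ maps each $T\in\mathcal{T}$ to a finite set of triple constraints $p::S^\mu$ with $p\in\mathbf{Iri}$, $S\in\mathcal{T}\cup\{\mathit{Lit}\}$ ($\mathit{Lit}$ a reserved symbol), $\mu\in\{1,?,*,+\}$, such that for each $T$ and $p$, $\delta(T)$ contains at most one triple constraint using $p$. **Weak recursion.** The dependency graph of $\mathbf{S}$ is the directed graph on node set $\mathcal{T}$ with an edge from $T$ to $T'$ for each triple constraint $p::T'^\mu\in\delta(T)$ with $T'\in\mathcal{T}$; the edge is strong if $\mu\in\{1,+\}$ and weak if $\mu\in\{*,?\}$ (there may be both a strong and a weak edge from $T$ to $T'$). $\mathbf{S}$ is strongly-recursive if this graph has a directed cycle (self-loops included) consisting of strong edges only, and weakly-recursive otherwise. **Typed graphs.** An RDF graph is a set of triples in $(\mathbf{Iri}\cup\mathbf{Blank})\times\mathbf{Iri}\times(\mathbf{Iri}\cup\mathbf{Blank}\cup\mathbf{Lit})$; its nodes are the elements occurring in first or third position of a triple. A $\mathcal{T}$-typed graph is a pair $(G,\mathit{typing})$ with $G$ an RDF graph and $\mathit{typing}$ a map from nodes of $G$ to subsets of $\mathcal{T}\cup\{\mathit{Lit}\}$. It is identified with the relational structure over $\mathcal{G}_{\mathcal T}=\{\mathit{Triple}\}\cup\mathcal{T}\cup\{\mathit{Lit}\}$ ($\mathit{Triple}$ ternary, the others unary) with facts $\mathit{Triple}(s,p,o)$ for $(s,p,o)\in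 G$ and $T(n)$ for $n$ a node and $T\in\mathit{typing}(n)$. **Dependencies of the schema.** $\Sigma_{\mathbf{S}}$ consists, for each $T\in\mathcal{T}$ and each $p::S^\mu\in\delta(T)$, of: - the tgd $\forall x,y.\ T(x)\wedge\mathit{Triple}(x,p,y)\Rightarrow S(y)$; - if $\mu\in\{1,+\}$, the tgd $\mathit{mult}^{\geq 1}(T,p) = \forall x.\ T(x)\Rightarrow\exists y.\,\mathit{Triple}(x,p,y)$; - if $\mu\in\{1,?\}$, the egd $\forall x,y,z.\ T(x)\wedge\mathit{Triple}(x,p,y)\wedge\mathit{Triple}(x,p,z)\Rightarrow y=z$. **Data exchange setting.** $\mathcal{E}=(\mathbf{R},\mathbf{S},\Sigma_{\mathrm{st}},\mathcal{F},F_{\mathrm{int}})$ where $\mathbf{R}=(\mathcal{R},\Sigma_{\mathrm{fd}})$ is a relational schema, $\mathbf{S}=(\mathcal{T},\delta)$ is a ShEx schema, $\mathcal{F}$ is a finite set of function symbols (IRI constructors) with arities, $F_{\mathrm{int}}$ interprets each $f\in\mathcal{F}$ of arity $n$ as a function $\mathbf{Dom}^n\to\mathbf{Iri}$, distinct function symbols having interpretations with disjoint ranges, and $\Sigma_{\mathrm{st}}$ is a finite set of source-to-target dependencies (st-tgds) $\forall\mathbf{x}.\ \varphi\Rightarrow\psi$, with $\varphi$ a conjunction of relational atoms over $\mathcal{R}$ (whose arguments are variables or constants) having free variables $\mathbf{x}$, and $\psi$ a conjunction of atoms over $\mathcal{G}_{\mathcal T}\cup\mathcal{F}$ (function terms are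 not nested). **Fully-typed.** $\mathcal{E}$ is fully-typed if every st-tgd has the form $\forall\mathbf{x}.\ \varphi\Rightarrow\mathit{Triple}(s,p,o)\wedge T_s(s)\wedge T_o(o)$ where: $p\in\mathbf{Iri}$; $s=f(\mathbf{y})$ with $f\in\mathcal{F}$, $\mathbf{y}$ a vector of variables from $\mathbf{x}$, and $T_s\in\mathcal{T}$; either $o=g(\mathbf{z})$ with $g\in\mathcal{F}$, $\mathbf{z}$ a vector of variables from $\mathbf{x}$, and $T_o\in\mathcal{T}$, or $o=z$ is a variable of $\mathbf{x}$ and $T_o=\mathit{Lit}$; moreover $p::T_o^\mu\in\delta(T_s)$ for some $\mu$; and every $f\in\mathcal{F}$ is used with a unique type in $\mathcal{T}$ (across all its occurrences in subject or object position in $\Sigma_{\mathrm{st}}$). **Solutions.** For a valid instance $I$ of $\mathbf{R}$, a solution for $I$ w.r.t. $\mathcal{E}$ is any $\mathcal{T}$-typed graph $J$ with $I\cup J\cup F_{\mathrm{int}}\models\Sigma_{\mathrm{st}}$ and $J\models\Sigma_{\mathbf{S}}$. A homomorphism $h:K_1\to K_2$ between structures over the same relational signature is a map $\mathit{dom}(K_1)\to\mathit{dom}(K_2)$ with $h(a)=a$ for all $a\in\mathit{dom}(K_1)\setminus\mathbf{Null}$ and $h(\mathbf{a})\in R^{K_2}$ whenever $\mathbf{a}\in R^{K_1}$. A solution $J$ is universal if for every solution $J'$ for $I$ w.r.t. $\mathcal{E}$ there is a homomorphism $J\to J'$. **Chase.** Let $K$ be an instance over $\mathcal{R}\cup\mathcal{G}_{\mathcal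 T}$. For a conjunction $\phi$ of atoms without function terms, a homomorphism $h:\phi\to K$ is an assignment of values to the variables of $\phi$ such that the image of every atom is a fact of $K$. - An st-tgd or tgd $\forall\mathbf{x}.\ \phi\Rightarrow\psi$ is applicable to $K$ with a homomorphism $h:\phi\to K$ if $\psi$ has no existential quantifier and $K\cup F_{\mathrm{int}},h\not\models\psi$, or $\psi=\exists\mathbf{y}.\psi'$ and no extension $h'$ of $h$ to $\mathbf{y}$ satisfies $K\cup F_{\mathrm{int}},h'\models\psi'$. The result is $K$ together with the facts of $\psi$ under $h$ (function terms evaluated with $F_{\mathrm{int}}$), respectively of $\psi'$ under the extension $h'$ of $h$ sending each $y\in\mathbf{y}$ to a fresh null: for $\mathit{mult}^{\geq1}(T,p)$ with $p::S^\mu\in\delta(T)$, the fresh null is in $\mathbf{NullLit}\setminus\mathit{dom}(K)$ if $S=\mathit{Lit}$, and in $\mathbf{Blank}\setminus\mathit{dom}(K)$ if $S\in\mathcal{T}$. - An egd $\forall\mathbf{x}.\ \phi\Rightarrow x=x'$ is applicable to $K$ with a homomorphism $h:\phi\to K$ if $h(x)\ne h(x')$. If one of $h(x),h(x')$ is a null, the result is obtained by replacing that null by the other value in all facts of $K$; if both are non-null, the result is the failure $\bot$. A chase sequence of $I$ with a set $\Sigma$ of dependencies is a finite or infinite sequence of such chase steps with dependencies from $\Sigma$, starting from $I$, each step applied to the result of the previous one. A finite maximal chase sequence either ends in $\bot$ (it fails) or ends in an instance $K$ to which no dependency of $\Sigma$ is applicable; in the latter case it computes the restriction of $K$ to the target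 signature $\mathcal{G}_{\mathcal T}$. *)

theory Defs
  imports Main "HOL-Library.Extended_Nat" "HOL-Library.Countable_Set"
begin

section \<open>Domain\<close>

text \<open>The domain is the whole type \<open>'v\<close>.\<close>

record 'v rdf_domain =
  iris :: "'v set"
  lits :: "'v set"
  blanks :: "'v set"
  null_lits :: "'v set"

definition wf_domain :: "'v rdf_domain \<Rightarrow> bool" where
  "wf_domain D \<longleftrightarrow>
     countable (UNIV :: 'v set) \<and>
     iris D \<union> lits D \<union> blanks D = UNIV \<and>
     iris D \<inter> lits D = {} \<and> iris D \<inter> blanks D = {} \<and> lits D \<inter> blanks D = {} \<and>
     infinite (iris D) \<and> infinite (lits D) \<and> infinite (blanks D) \<and>
     null_lits D \<subseteq> lits D \<and> infinite (null_lits D)"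

definition nulls :: "'v rdf_domain \<Rightarrow> 'v set" where
  "nulls D = null_lits D \<union> blanks D"


section \<open>Relational structures\<close>

text \<open>\<open>LitShape\<close> is the reserved symbol \<open>Lit\<close>, so it is never a shape name. A structure is a set
  of facts; a source instance only has facts over symbols \<open>Src r\<close>.\<close>

datatype 't shape = Ty 't | LitShape

datatype ('r, 't) sym = Src 'r | Triple | Shape "'t shape"

type_synonym ('r, 't, 'v) struct = "(('r, 't) sym \<times> 'v list) set"

definition dom_of :: "('r, 't, 'v) struct \<Rightarrow> 'v set" where
  "dom_of K = (\<Union>(R, as)\<in>K. set as)"

definition homomorphism ::
  "'v rdf_domain \<Rightarrow> ('r, 't, 'v) struct \<Rightarrow> ('r, 't, 'v) struct \<Rightarrow> ('v \<Rightarrow> 'v) \<Rightarrow> bool" where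
  "homomorphism D K1 K2 h \<longleftrightarrow>
     (\<forall>a\<in>dom_of K1. h a \<in> dom_of K2) \<and>
     (\<forall>a\<in>dom_of K1 - nulls D. h a = a) \<and>
     (\<forall>(R, as)\<in>K1. (R, map h as) \<in> K2)"


section \<open>Source schemas\<close>

text \<open>Positions in functional dependencies are numbered from 1.\<close>

record 'r rel_schema =
  rels :: "'r set"
  rel_arity :: "'r \<Rightarrow> nat"
  fds :: "('r \<times> nat set \<times> nat set) set"

definition wf_rel_schema :: "'r rel_schema \<Rightarrow> bool" where
  "wf_rel_schema R \<longleftrightarrow>
     finite (rels R) \<and>
     (\<forall>(r, X, Y)\<in>fds R. r \<in> rels R \<and> X \<subseteq> {1..rel_arity R r} \<and> Y \<subseteq> {1..rel_arity R r})"

definition sat_fd :: "('r, 't, 'v) struct \<Rightarrow> 'r \<times> nat set \<times> nat set \<Rightarrow> bool" where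
  "sat_fd I = (\<lambda>(r, X, Y). \<forall>a b. (Src r, a) \<in> I \<and> (Src r, b) \<in> I \<and>
     (\<forall>i\<in>X. a ! (i - 1) = b ! (i - 1)) \<longrightarrow> (\<forall>i\<in>Y. a ! (i - 1) = b ! (i - 1)))"

definition source_instance ::
  "'v rdf_domain \<Rightarrow> 'r rel_schema \<Rightarrow> ('r, 't, 'v) struct \<Rightarrow> bool" where
  "source_instance D R I \<longleftrightarrow>
     finite I \<and> dom_of I \<subseteq> lits D - null_lits D \<and>
     (\<forall>(s, as)\<in>I. \<exists>r\<in>rels R. s = Src r \<and> length as = rel_arity R r)"

definition valid_instance ::
  "'v rdf_domain \<Rightarrow> 'r rel_schema \<Rightarrow> ('r, 't, 'v) struct \<Rightarrow> bool" where
  "valid_instance D R I \<longleftrightarrow> source_instance D R I \<and> (\<forall>fd\<in>fds R. sat_fd I fd)"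


section \<open>ShEx schemas\<close>

text \<open>The multiplicities are \<open>1\<close>, \<open>?\<close>, \<open>*\<close> and \<open>+\<close>; a triple constraint \<open>p::S\<^sup>\<mu>\<close> is
  \<open>(p, S, \<mu>)\<close>. The values of \<open>delta\<close> outside \<open>shape_names\<close> are irrelevant.\<close>

datatype multiplicity = MOne | MOpt | MStar | MPlus

record ('t, 'v) shex_schema =
  shape_names :: "'t set"
  delta :: "'t \<Rightarrow> ('v \<times> 't shape \<times> multiplicity) set"

definition shapes :: "('t, 'v) shex_schema \<Rightarrow> 't shape set" where
  "shapes S = Ty ` shape_names S \<union> {LitShape}"

definition wf_shex :: "'v rdf_domain \<Rightarrow> ('t, 'v) shex_schema \<Rightarrow> bool" where
  "wf_shex D S \<longleftrightarrow>
     finite (shape_names S) \<and>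
     (\<forall>T\<in>shape_names S.
        finite (delta S T) \<and>
        (\<forall>(p, U, \<mu>)\<in>delta S T. p \<in> iris D \<and> U \<in> shapes S) \<and>
        (\<forall>p U \<mu> U' \<mu>'. (p, U, \<mu>) \<in> delta S T \<and> (p, U', \<mu>') \<in> delta S T \<longrightarrow> U = U' \<and> \<mu> = \<mu>'))"

datatype edge_kind = Strong | Weak

definition edge_kind_of :: "multiplicity \<Rightarrow> edge_kind" where
  "edge_kind_of \<mu> = (if \<mu> \<in> {MOne, MPlus} then Strong else Weak)"

definition dependency_graph :: "('t, 'v) shex_schema \<Rightarrow> ('t \<times> edge_kind \<times> 't) set" where
  "dependency_graph S =
     {(T, edge_kind_of \<mu>, T') |T T' \<mu>.
        T \<in> shape_names S \<and> T' \<in> shape_names S \<and> (\<exists>p. (p, Ty T', \<mu>) \<in> delta S T)}"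

definition strong_edges :: "('t, 'v) shex_schema \<Rightarrow> ('t \<times> 't) set" where
  "strong_edges S = {(T, T'). (T, Strong, T') \<in> dependency_graph S}"

definition strongly_recursive :: "('t, 'v) shex_schema \<Rightarrow> bool" where
  "strongly_recursive S \<longleftrightarrow> (\<exists>T. (T, T) \<in> (strong_edges S)\<^sup>+)"

definition weakly_recursive :: "('t, 'v) shex_schema \<Rightarrow> bool" where
  "weakly_recursive S \<longleftrightarrow> \<not> strongly_recursive S"


section \<open>Typed graphs\<close>

definition rdf_graph :: "'v rdf_domain \<Rightarrow> ('v \<times> 'v \<times> 'v) set \<Rightarrow> bool" where
  "rdf_graph D G \<longleftrightarrow>
     G \<subseteq> (iris D \<union> blanks D) \<times> iris D \<times> (iris D \<union> blanks D \<union> lits D)"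

definition nodes :: "('v \<times> 'v \<times> 'v) set \<Rightarrow> 'v set" where
  "nodes G = {n. \<exists>s p t. (s, p, t) \<in> G \<and> (n = s \<or> n = t)}"

definition graph_struct ::
  "('v \<times> 'v \<times> 'v) set \<Rightarrow> ('v \<Rightarrow> 't shape set) \<Rightarrow> ('r, 't, 'v) struct" where
  "graph_struct G typing =
     {(Triple, [s, p, t]) |s p t. (s, p, t) \<in> G} \<union>
     {(Shape U, [n]) |U n. n \<in> nodes G \<and> U \<in> typing n}"

definition typed_graph ::
  "'v rdf_domain \<Rightarrow> ('t, 'v) shex_schema \<Rightarrow> ('r, 't, 'v) struct \<Rightarrow> bool" where
  "typed_graph D S J \<longleftrightarrow>
     (\<exists>G typing. rdf_graph D G \<and> (\<forall>n\<in>nodes G. typing n \<subseteq> shapes S) \<and> J = graph_struct G typing)"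


section \<open>Dependencies\<close>

text \<open>Function terms are not nested and only occur in heads. Conjunctions are lists of atoms.
  In \<open>ExTgd \<phi> y U \<psi>\<close> (read \<open>\<phi> \<Rightarrow> \<exists>y. \<psi>\<close>) the annotation \<open>U\<close> does not affect satisfaction; it
  selects the kind of fresh null that a chase step creates for \<open>y\<close>.\<close>

datatype 'v bterm = Var nat | Const 'v

datatype ('f, 'v) trm = Base "'v bterm" | App 'f "'v bterm list"

type_synonym ('r, 't, 'v) body = "(('r, 't) sym \<times> 'v bterm list) list"
type_synonym ('r, 't, 'f, 'v) head = "(('r, 't) sym \<times> ('f, 'v) trm list) list"

datatype ('r, 't, 'f, 'v) dep =
    Tgd "('r, 't, 'v) body" "('r, 't, 'f, 'v) head"
  | ExTgd "('r, 't, 'v) body" nat "'t shape" "('r, 't, 'f, 'v) head"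
  | Egd "('r, 't, 'v) body" nat nat

fun bterm_vars :: "'v bterm \<Rightarrow> nat set" where
  "bterm_vars (Var x) = {x}"
| "bterm_vars (Const c) = {}"

fun trm_vars :: "('f, 'v) trm \<Rightarrow> nat set" where
  "trm_vars (Base b) = bterm_vars b"
| "trm_vars (App f bs) = (\<Union>b\<in>set bs. bterm_vars b)"

definition body_vars :: "('r, 't, 'v) body \<Rightarrow> nat set" where
  "body_vars \<phi> = (\<Union>(R, bs)\<in>set \<phi>. \<Union>b\<in>set bs. bterm_vars b)"

fun eval_bterm :: "(nat \<Rightarrow> 'v) \<Rightarrow> 'v bterm \<Rightarrow> 'v" where
  "eval_bterm h (Var x) = h x"
| "eval_bterm h (Const c) = c"

fun eval_trm :: "('f \<Rightarrow> 'v list \<Rightarrow> 'v) \<Rightarrow> (nat \<Rightarrow> 'v) \<Rightarrow> ('f, 'v) trm \<Rightarrow> 'v" where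
  "eval_trm F h (Base b) = eval_bterm h b"
| "eval_trm F h (App f bs) = F f (map (eval_bterm h) bs)"

text \<open>Assignments are total functions; only their values on the variables of the dependency
  matter.\<close>

definition body_hom :: "(nat \<Rightarrow> 'v) \<Rightarrow> ('r, 't, 'v) body \<Rightarrow> ('r, 't, 'v) struct \<Rightarrow> bool" where
  "body_hom h \<phi> K \<longleftrightarrow> (\<forall>(R, bs)\<in>set \<phi>. (R, map (eval_bterm h) bs) \<in> K)"

definition head_facts ::
  "('f \<Rightarrow> 'v list \<Rightarrow> 'v) \<Rightarrow> (nat \<Rightarrow> 'v) \<Rightarrow> ('r, 't, 'f, 'v) head \<Rightarrow> ('r, 't, 'v) struct" where
  "head_facts F h \<psi> = (\<lambda>(R, ts). (R, map (eval_trm F h) ts)) ` set \<psi>"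

fun dep_body :: "('r, 't, 'f, 'v) dep \<Rightarrow> ('r, 't, 'v) body" where
  "dep_body (Tgd \<phi> \<psi>) = \<phi>"
| "dep_body (ExTgd \<phi> y U \<psi>) = \<phi>"
| "dep_body (Egd \<phi> x x') = \<phi>"

fun conclusion_holds ::
  "('f \<Rightarrow> 'v list \<Rightarrow> 'v) \<Rightarrow> ('r, 't, 'v) struct \<Rightarrow> (nat \<Rightarrow> 'v) \<Rightarrow> ('r, 't, 'f, 'v) dep \<Rightarrow> bool" where
  "conclusion_holds F K h (Tgd \<phi> \<psi>) \<longleftrightarrow> head_facts F h \<psi> \<subseteq> K"
| "conclusion_holds F K h (ExTgd \<phi> y U \<psi>) \<longleftrightarrow> (\<exists>v. head_facts F (h(y := v)) \<psi> \<subseteq> K)"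
| "conclusion_holds F K h (Egd \<phi> x x') \<longleftrightarrow> h x = h x'"

definition sat_dep ::
  "('f \<Rightarrow> 'v list \<Rightarrow> 'v) \<Rightarrow> ('r, 't, 'v) struct \<Rightarrow> ('r, 't, 'f, 'v) dep \<Rightarrow> bool" where
  "sat_dep F K d \<longleftrightarrow> (\<forall>h. body_hom h (dep_body d) K \<longrightarrow> conclusion_holds F K h d)"


section \<open>Dependencies of a ShEx schema\<close>

definition typing_tgd :: "'t \<Rightarrow> 'v \<Rightarrow> 't shape \<Rightarrow> ('r, 't, 'f, 'v) dep" where
  "typing_tgd T p U =
     Tgd [(Shape (Ty T), [Var 0]), (Triple, [Var 0, Const p, Var 1])]
         [(Shape U, [Base (Var 1)])]"

definition mult_ge1_tgd :: "'t \<Rightarrow> 'v \<Rightarrow> 't shape \<Rightarrow> ('r, 't, 'f, 'v) dep" where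
  "mult_ge1_tgd T p U =
     ExTgd [(Shape (Ty T), [Var 0])] 1 U
           [(Triple, [Base (Var 0), Base (Const p), Base (Var 1)])]"

definition mult_le1_egd :: "'t \<Rightarrow> 'v \<Rightarrow> ('r, 't, 'f, 'v) dep" where
  "mult_le1_egd T p =
     Egd [(Shape (Ty T), [Var 0]),
          (Triple, [Var 0, Const p, Var 1]), (Triple, [Var 0, Const p, Var 2])] 1 2"

definition shex_deps :: "('t, 'v) shex_schema \<Rightarrow> ('r, 't, 'f, 'v) dep set" where
  "shex_deps S =
     {typing_tgd T p U |T p U \<mu>. T \<in> shape_names S \<and> (p, U, \<mu>) \<in> delta S T} \<union>
     {mult_ge1_tgd T p U |T p U \<mu>.
        T \<in> shape_names S \<and> (p, U, \<mu>) \<in> delta S T \<and> \<mu> \<in> {MOne, MPlus}} \<union>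
     {mult_le1_egd T p |T p U \<mu>.
        T \<in> shape_names S \<and> (p, U, \<mu>) \<in> delta S T \<and> \<mu> \<in> {MOne, MOpt}}"


section \<open>Data exchange settings\<close>

record ('r, 't, 'f, 'v) setting =
  source :: "'r rel_schema"
  target :: "('t, 'v) shex_schema"
  st_tgds :: "('r, 't, 'f, 'v) dep set"
  funs :: "'f set"
  fun_arity :: "'f \<Rightarrow> nat"
  fun_int :: "'f \<Rightarrow> 'v list \<Rightarrow> 'v"

definition fun_range :: "('r, 't, 'f, 'v) setting \<Rightarrow> 'f \<Rightarrow> 'v set" where
  "fun_range E f = fun_int E f ` {as. length as = fun_arity E f}"

fun wf_trm :: "('r, 't, 'f, 'v) setting \<Rightarrow> nat set \<Rightarrow> ('f, 'v) trm \<Rightarrow> bool" where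
  "wf_trm E V (Base b) \<longleftrightarrow> bterm_vars b \<subseteq> V"
| "wf_trm E V (App f bs) \<longleftrightarrow>
     f \<in> funs E \<and> length bs = fun_arity E f \<and> trm_vars (App f bs) \<subseteq> V"

fun target_arity :: "('t, 'v) shex_schema \<Rightarrow> ('r, 't) sym \<Rightarrow> nat \<Rightarrow> bool" where
  "target_arity S (Src r) n \<longleftrightarrow> False"
| "target_arity S Triple n \<longleftrightarrow> n = 3"
| "target_arity S (Shape U) n \<longleftrightarrow> U \<in> shapes S \<and> n = 1"

definition wf_st_tgd :: "('r, 't, 'f, 'v) setting \<Rightarrow> ('r, 't, 'f, 'v) dep \<Rightarrow> bool" where
  "wf_st_tgd E d \<longleftrightarrow>
     (\<exists>\<phi> \<psi>. d = Tgd \<phi> \<psi> \<and>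
        (\<forall>(R, bs)\<in>set \<phi>. \<exists>r\<in>rels (source E). R = Src r \<and> length bs = rel_arity (source E) r) \<and>
        (\<forall>(R, ts)\<in>set \<psi>. target_arity (target E) R (length ts) \<and>
           (\<forall>t\<in>set ts. wf_trm E (body_vars \<phi>) t)))"

definition data_exchange_setting ::
  "'v rdf_domain \<Rightarrow> ('r, 't, 'f, 'v) setting \<Rightarrow> bool" where
  "data_exchange_setting D E \<longleftrightarrow>
     wf_rel_schema (source E) \<and> wf_shex D (target E) \<and>
     finite (funs E) \<and>
     (\<forall>f\<in>funs E. fun_range E f \<subseteq> iris D) \<and>
     (\<forall>f\<in>funs E. \<forall>g\<in>funs E. f \<noteq> g \<longrightarrow> fun_range E f \<inter> fun_range E g = {}) \<and>
     finite (st_tgds E) \<and> (\<forall>d\<in>st_tgds E. wf_st_tgd E d)"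

definition constructor_term ::
  "('r, 't, 'f, 'v) setting \<Rightarrow> ('r, 't, 'v) body \<Rightarrow> ('f, 'v) trm \<Rightarrow> bool" where
  "constructor_term E \<phi> t \<longleftrightarrow>
     (\<exists>f\<in>funs E. \<exists>ys. length ys = fun_arity E f \<and> set ys \<subseteq> body_vars \<phi> \<and> t = App f (map Var ys))"

definition used_with_type :: "('r, 't, 'f, 'v) setting \<Rightarrow> 'f \<Rightarrow> 't \<Rightarrow> bool" where
  "used_with_type E f T \<longleftrightarrow>
     (\<exists>\<phi> \<psi> bs. Tgd \<phi> \<psi> \<in> st_tgds E \<and> (Shape (Ty T), [App f bs]) \<in> set \<psi>)"

definition fully_typed :: "'v rdf_domain \<Rightarrow> ('r, 't, 'f, 'v) setting \<Rightarrow> bool" where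
  "fully_typed D E \<longleftrightarrow>
     (\<forall>d\<in>st_tgds E. \<exists>\<phi> s p t Ts U \<mu>.
        d = Tgd \<phi> [(Triple, [s, Base (Const p), t]), (Shape (Ty Ts), [s]), (Shape U, [t])] \<and>
        p \<in> iris D \<and>
        constructor_term E \<phi> s \<and> Ts \<in> shape_names (target E) \<and>
        (constructor_term E \<phi> t \<and> (\<exists>To\<in>shape_names (target E). U = Ty To) \<or>
         (\<exists>z\<in>body_vars \<phi>. t = Base (Var z) \<and> U = LitShape)) \<and>
        (p, U, \<mu>) \<in> delta (target E) Ts) \<and>
     (\<forall>f\<in>funs E. \<forall>T T'. used_with_type E f T \<and> used_with_type E f T' \<longrightarrow> T = T')"


section \<open>Solutions\<close>

definition solution ::
  "'v rdf_domain \<Rightarrow> ('r, 't, 'f, 'v) setting \<Rightarrow> ('r, 't, 'v) struct \<Rightarrow> ('r, 't, 'v) struct \<Rightarrow> bool"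
  where
  "solution D E I J \<longleftrightarrow>
     typed_graph D (target E) J \<and>
     (\<forall>d\<in>st_tgds E. sat_dep (fun_int E) (I \<union> J) d) \<and>
     (\<forall>d\<in>shex_deps (target E). sat_dep (fun_int E) J d)"

definition universal_solution ::
  "'v rdf_domain \<Rightarrow> ('r, 't, 'f, 'v) setting \<Rightarrow> ('r, 't, 'v) struct \<Rightarrow> ('r, 't, 'v) struct \<Rightarrow> bool"
  where
  "universal_solution D E I J \<longleftrightarrow>
     solution D E I J \<and> (\<forall>J'. solution D E I J' \<longrightarrow> (\<exists>h. homomorphism D J J' h))"


section \<open>Chase\<close>

definition applicable ::
  "('f \<Rightarrow> 'v list \<Rightarrow> 'v) \<Rightarrow> ('r, 't, 'v) struct \<Rightarrow> ('r, 't, 'f, 'v) dep \<Rightarrow> (nat \<Rightarrow> 'v) \<Rightarrow> bool" where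
  "applicable F K d h \<longleftrightarrow> body_hom h (dep_body d) K \<and> \<not> conclusion_holds F K h d"

fun null_kind :: "'v rdf_domain \<Rightarrow> 't shape \<Rightarrow> 'v set" where
  "null_kind D LitShape = null_lits D"
| "null_kind D (Ty T) = blanks D"

definition replace :: "'v \<Rightarrow> 'v \<Rightarrow> ('r, 't, 'v) struct \<Rightarrow> ('r, 't, 'v) struct" where
  "replace a b K = (\<lambda>(R, as). (R, map (\<lambda>c. if c = a then b else c) as)) ` K"

text \<open>The failure \<open>\<bottom>\<close> is \<open>None\<close>. An egd step that equates two nulls may replace either one.\<close>

inductive chase_step ::
  "'v rdf_domain \<Rightarrow> ('f \<Rightarrow> 'v list \<Rightarrow> 'v) \<Rightarrow> ('r, 't, 'f, 'v) dep set \<Rightarrow>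
   ('r, 't, 'v) struct \<Rightarrow> ('r, 't, 'v) struct option \<Rightarrow> bool"
  for D F \<Sigma> K where
  tgd: "Tgd \<phi> \<psi> \<in> \<Sigma> \<Longrightarrow> applicable F K (Tgd \<phi> \<psi>) h \<Longrightarrow>
    chase_step D F \<Sigma> K (Some (K \<union> head_facts F h \<psi>))"
| ex_tgd: "ExTgd \<phi> y U \<psi> \<in> \<Sigma> \<Longrightarrow> applicable F K (ExTgd \<phi> y U \<psi>) h \<Longrightarrow>
    v \<in> null_kind D U - dom_of K \<Longrightarrow>
    chase_step D F \<Sigma> K (Some (K \<union> head_facts F (h(y := v)) \<psi>))"
| egd_left: "Egd \<phi> x x' \<in> \<Sigma> \<Longrightarrow> applicable F K (Egd \<phi> x x') h \<Longrightarrow> h x \<in> nulls D \<Longrightarrow>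
    chase_step D F \<Sigma> K (Some (replace (h x) (h x') K))"
| egd_right: "Egd \<phi> x x' \<in> \<Sigma> \<Longrightarrow> applicable F K (Egd \<phi> x x') h \<Longrightarrow> h x' \<in> nulls D \<Longrightarrow>
    chase_step D F \<Sigma> K (Some (replace (h x') (h x) K))"
| egd_fail: "Egd \<phi> x x' \<in> \<Sigma> \<Longrightarrow> applicable F K (Egd \<phi> x x') h \<Longrightarrow>
    h x \<notin> nulls D \<Longrightarrow> h x' \<notin> nulls D \<Longrightarrow>
    chase_step D F \<Sigma> K None"

text \<open>A chase sequence with \<open>N\<close> steps, \<open>N\<close> possibly infinite, is given by the states \<open>\<sigma> i\<close> with
  \<open>i \<le> N\<close>; the values of \<open>\<sigma>\<close> beyond \<open>N\<close> are irrelevant.\<close>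

definition chase_sequence ::
  "'v rdf_domain \<Rightarrow> ('f \<Rightarrow> 'v list \<Rightarrow> 'v) \<Rightarrow> ('r, 't, 'f, 'v) dep set \<Rightarrow> ('r, 't, 'v) struct \<Rightarrow>
   enat \<Rightarrow> (nat \<Rightarrow> ('r, 't, 'v) struct option) \<Rightarrow> bool" where
  "chase_sequence D F \<Sigma> I N \<sigma> \<longleftrightarrow>
     \<sigma> 0 = Some I \<and>
     (\<forall>i. enat i < N \<longrightarrow> (\<exists>K. \<sigma> i = Some K \<and> chase_step D F \<Sigma> K (\<sigma> (Suc i))))"

definition final_state ::
  "('f \<Rightarrow> 'v list \<Rightarrow> 'v) \<Rightarrow> ('r, 't, 'f, 'v) dep set \<Rightarrow> ('r, 't, 'v) struct option \<Rightarrow> bool" where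
  "final_state F \<Sigma> s \<longleftrightarrow> (\<forall>K. s = Some K \<longrightarrow> (\<forall>d\<in>\<Sigma>. \<forall>h. \<not> applicable F K d h))"

definition maximal_chase_sequence ::
  "'v rdf_domain \<Rightarrow> ('f \<Rightarrow> 'v list \<Rightarrow> 'v) \<Rightarrow> ('r, 't, 'f, 'v) dep set \<Rightarrow> ('r, 't, 'v) struct \<Rightarrow>
   enat \<Rightarrow> (nat \<Rightarrow> ('r, 't, 'v) struct option) \<Rightarrow> bool" where
  "maximal_chase_sequence D F \<Sigma> I N \<sigma> \<longleftrightarrow>
     chase_sequence D F \<Sigma> I N \<sigma> \<and> (\<forall>n. N = enat n \<longrightarrow> final_state F \<Sigma> (\<sigma> n))"

definition chase_fails :: "enat \<Rightarrow> (nat \<Rightarrow> ('r, 't, 'v) struct option) \<Rightarrow> bool" where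
  "chase_fails N \<sigma> \<longleftrightarrow> (\<exists>n. N = enat n \<and> \<sigma> n = None)"

definition restrict_target ::
  "('t, 'v) shex_schema \<Rightarrow> ('r, 't, 'v) struct \<Rightarrow> ('r, 't, 'v) struct" where
  "restrict_target S K = {(R, as) \<in> K. R \<in> insert Triple (Shape ` shapes S)}"

text \<open>To be used for maximal chase sequences, whose last state is final.\<close>

definition chase_computes ::
  "('t, 'v) shex_schema \<Rightarrow> enat \<Rightarrow> (nat \<Rightarrow> ('r, 't, 'v) struct option) \<Rightarrow>
   ('r, 't, 'v) struct \<Rightarrow> bool" where
  "chase_computes S N \<sigma> J \<longleftrightarrow>
     (\<exists>n K. N = enat n \<and> \<sigma> n = Some K \<and> J = restrict_target S K)"

definition setting_deps :: "('r, 't, 'f, 'v) setting \<Rightarrow> ('r, 't, 'f, 'v) dep set" where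
  "setting_deps E = st_tgds E \<union> shex_deps (target E)"

end

theory Submission
  imports Defs
begin

text \<open>In a fully-typed setting every value of a chase state has exactly one shape: an IRI \<open>f(a)\<close> has
  the type of \<open>f\<close>, literals have shape \<open>Lit\<close>, and the shape of a blank node is fixed when it is
  created. An egd therefore only merges values of the same shape. Call a constraint of a value open
  if it requires a successor that the value does not have yet. Since the strong edges are acyclic,
  shapes can be weighted such that closing a constraint with a fresh null outweighs all constraints
  that the null opens; as egds and full tgds open none, every chase sequence is finite.
  As each chase state maps homomorphically into each solution, a chase can only fail if
  there is no solution, and otherwise its result is a universal one.\<close>

section \<open>Satisfaction of the dependencies\<close>

lemma dom_of_simps [simp]:
  "dom_of {} = {}"
  "dom_of (insert (R, as) K) = set as \<union> dom_of K"
  "dom_of (K \<union> L) = dom_of K \<union> dom_of L"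
  by (auto simp: dom_of_def)

lemma in_dom_ofI: "(R, as) \<in> K \<Longrightarrow> a \<in> set as \<Longrightarrow> a \<in> dom_of K"
  by (auto simp: dom_of_def)

lemma finite_dom_of: "finite K \<Longrightarrow> finite (dom_of K)"
  by (auto simp: dom_of_def)

lemma not_applicable_iff_sat_dep: "(\<forall>h. \<not> applicable F K d h) \<longleftrightarrow> sat_dep F K d"
  by (auto simp: applicable_def sat_dep_def)

lemma sat_typing_tgd:
  "sat_dep F K (typing_tgd T p U) \<longleftrightarrow>
    (\<forall>x y. (Shape (Ty T), [x]) \<in> K \<and> (Triple, [x, p, y]) \<in> K \<longrightarrow> (Shape U, [y]) \<in> K)"
    (is "?L \<longleftrightarrow> ?R")
proof
  assume L: ?L
  show ?R
  proof (intro allI impI)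
    fix x y assume "(Shape (Ty T), [x]) \<in> K \<and> (Triple, [x, p, y]) \<in> K"
    then show "(Shape U, [y]) \<in> K"
      using L[unfolded sat_dep_def, rule_format, of "\<lambda>n. if n = 0 then x else y"]
      by (simp add: typing_tgd_def body_hom_def head_facts_def)
  qed
qed (auto simp: sat_dep_def typing_tgd_def body_hom_def head_facts_def)

lemma sat_mult_ge1_tgd:
  "sat_dep F K (mult_ge1_tgd T p U) \<longleftrightarrow>
    (\<forall>x. (Shape (Ty T), [x]) \<in> K \<longrightarrow> (\<exists>y. (Triple, [x, p, y]) \<in> K))" (is "?L \<longleftrightarrow> ?R")
proof
  assume L: ?L
  show ?R
  proof (intro allI impI)
    fix x assume "(Shape (Ty T), [x]) \<in> K"
    then show "\<exists>y. (Triple, [x, p, y]) \<in> K"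
      using L[unfolded sat_dep_def, rule_format, of "\<lambda>n. x"]
      by (simp add: mult_ge1_tgd_def body_hom_def head_facts_def)
  qed
qed (auto simp: sat_dep_def mult_ge1_tgd_def body_hom_def head_facts_def)

lemma sat_mult_le1_egd:
  "sat_dep F K (mult_le1_egd T p) \<longleftrightarrow>
    (\<forall>x y z. (Shape (Ty T), [x]) \<in> K \<and> (Triple, [x, p, y]) \<in> K \<and> (Triple, [x, p, z]) \<in> K
      \<longrightarrow> y = z)" (is "?L \<longleftrightarrow> ?R")
proof
  assume L: ?L
  show ?R
  proof (intro allI impI)
    fix x y z
    assume "(Shape (Ty T), [x]) \<in> K \<and> (Triple, [x, p, y]) \<in> K \<and> (Triple, [x, p, z]) \<in> K"
    then show "y = z"
      using L[unfolded sat_dep_def, rule_format,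
          of "\<lambda>n. if n = 0 then x else if n = 1 then y else z"]
      by (simp add: mult_le1_egd_def body_hom_def)
  qed
qed (auto simp: sat_dep_def mult_le1_egd_def body_hom_def)

lemma body_hom_mono: "body_hom g \<phi> K \<Longrightarrow> K \<subseteq> L \<Longrightarrow> body_hom g \<phi> L"
  by (auto simp: body_hom_def)

lemma body_hom_vars_in_dom: "body_hom g \<phi> K \<Longrightarrow> x \<in> body_vars \<phi> \<Longrightarrow> g x \<in> dom_of K"
proof -
  assume *: "body_hom g \<phi> K" "x \<in> body_vars \<phi>"
  then obtain R bs b where "(R, bs) \<in> set \<phi>" "b \<in> set bs" "x \<in> bterm_vars b"
    by (auto simp: body_vars_def)
  moreover from this have "b = Var x" by (cases b) auto
  ultimately show ?thesis
    using *(1) by (force simp: body_hom_def intro!: in_dom_ofI[of R "map (eval_bterm g) bs"])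
qed

lemma dom_of_replace: "dom_of (replace a b K) = (\<lambda>c. if c = a then b else c) ` dom_of K"
  by (force simp: dom_of_def replace_def split: prod.splits)


section \<open>Weights of shapes\<close>

definition strong_constraints :: "('t, 'v) shex_schema \<Rightarrow> 't shape \<Rightarrow> ('v \<times> 't shape) set" where
  "strong_constraints S U =
    {(p, U') |p U' T \<mu>. U = Ty T \<and> T \<in> shape_names S \<and> (p, U', \<mu>) \<in> delta S T \<and> \<mu> \<in> {MOne, MPlus}}"

lemma finite_strong_constraints:
  assumes "wf_shex D S"
  shows "finite (strong_constraints S U)"
proof (cases "\<exists>T. U = Ty T \<and> T \<in> shape_names S")
  case True
  then obtain T where T: "U = Ty T" "T \<in> shape_names S" by blast
  then have "strong_constraints S U \<subseteq> (\<lambda>(p, U, \<mu>). (p, U)) ` delta S T"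
    by (force simp: strong_constraints_def)
  with T show ?thesis
    using assms by (auto simp: wf_shex_def intro: finite_subset)
next
  case False
  then have "strong_constraints S U = {}" by (auto simp: strong_constraints_def)
  then show ?thesis by simp
qed

fun shape_rank :: "('t, 'v) shex_schema \<Rightarrow> 't shape \<Rightarrow> nat" where
  "shape_rank S LitShape = 0"
| "shape_rank S (Ty T) = Suc (card ((strong_edges S)\<^sup>+ `` {T}))"

lemma shape_rank_decreases:
  assumes "wf_shex D S" and "weakly_recursive S" and "(p, U') \<in> strong_constraints S U"
  shows "shape_rank S U' < shape_rank S U"
proof -
  from assms(3) obtain T \<mu> where T: "U = Ty T" "T \<in> shape_names S" "(p, U', \<mu>) \<in> delta S T"
    "\<mu> \<in> {MOne, MPlus}" by (auto simp: strong_constraints_def)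
  show ?thesis
  proof (cases U')
    case (Ty T')
    have "U' \<in> shapes S" using assms(1) T(2,3) by (force simp: wf_shex_def)
    then have "T' \<in> shape_names S" using Ty by (auto simp: shapes_def)
    then have e: "(T, T') \<in> strong_edges S"
      using T Ty by (auto simp: strong_edges_def dependency_graph_def edge_kind_of_def)
    have "strong_edges S \<subseteq> shape_names S \<times> shape_names S"
      by (auto simp: strong_edges_def dependency_graph_def)
    from trancl_subset_Sigma[OF this] have "(strong_edges S)\<^sup>+ `` {T} \<subseteq> shape_names S"
      by blast
    then have fin: "finite ((strong_edges S)\<^sup>+ `` {T})"
      using assms(1) by (auto simp: wf_shex_def intro: finite_subset)
    have "(strong_edges S)\<^sup>+ `` {T'} \<subset> (strong_edges S)\<^sup>+ `` {T}"
    proof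
      show "(strong_edges S)\<^sup>+ `` {T'} \<subseteq> (strong_edges S)\<^sup>+ `` {T}"
        using e by (auto intro: trancl_into_trancl2)
      have "T' \<in> (strong_edges S)\<^sup>+ `` {T}" using e by auto
      moreover have "T' \<notin> (strong_edges S)\<^sup>+ `` {T'}"
        using assms(2) by (auto simp: weakly_recursive_def strongly_recursive_def)
      ultimately show "(strong_edges S)\<^sup>+ `` {T'} \<noteq> (strong_edges S)\<^sup>+ `` {T}" by blast
    qed
    then show ?thesis using T(1) Ty psubset_card_mono[OF fin] by simp
  qed (simp add: T(1))
qed

definition shape_weight :: "('t, 'v) shex_schema \<Rightarrow> 't shape \<Rightarrow> nat" where
  "shape_weight S U =
    Suc (\<Sum>T\<in>shape_names S. card (strong_constraints S (Ty T))) ^ shape_rank S U"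

lemma sum_strong_constraints_less_weight:
  assumes "wf_shex D S" and "weakly_recursive S"
  shows "(\<Sum>(p, U')\<in>strong_constraints S U. shape_weight S U') < shape_weight S U"
proof (cases "strong_constraints S U = {}")
  case True
  then show ?thesis by (simp add: shape_weight_def)
next
  case False
  then obtain T where T: "U = Ty T" "T \<in> shape_names S"
    by (auto simp: strong_constraints_def)
  define B where "B = (\<Sum>T\<in>shape_names S. card (strong_constraints S (Ty T)))"
  define n where "n = card ((strong_edges S)\<^sup>+ `` {T})"
  have "card (strong_constraints S U) \<le> B"
    unfolding B_def T(1) using assms(1) T(2)
    by (intro member_le_sum) (auto simp: wf_shex_def)
  moreover have "shape_weight S U' \<le> Suc B ^ n" if "(p, U') \<in> strong_constraints S U" for p U'
    using shape_rank_decreases[OF assms that] T(1)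
    unfolding shape_weight_def B_def[symmetric] n_def by (intro power_increasing) auto
  ultimately have "(\<Sum>(p, U')\<in>strong_constraints S U. shape_weight S U') \<le> B * Suc B ^ n"
    using sum_bounded_above[of "strong_constraints S U" "\<lambda>(p, U'). shape_weight S U'" "Suc B ^ n"]
    by (fastforce intro: le_trans[OF _ mult_right_mono])
  also have "\<dots> < Suc B * Suc B ^ n" by simp
  also have "\<dots> = shape_weight S U" by (simp add: shape_weight_def B_def n_def T(1))
  finally show ?thesis .
qed


section \<open>Invariants of the chase\<close>

locale weakly_recursive_setting =
  fixes D :: "'v rdf_domain"
    and E :: "('r, 't, 'f, 'v) setting"
    and I :: "('r, 't, 'v) struct"
  assumes dom: "wf_domain D"
    and setting: "data_exchange_setting D E"
    and typed: "fully_typed D E"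
    and valid: "valid_instance D (source E) I"
    and weak: "weakly_recursive (target E)"
begin

abbreviation "F \<equiv> fun_int E"
abbreviation "S \<equiv> target E"
abbreviation "\<Sigma> \<equiv> setting_deps E"

lemma schema: "wf_shex D S"
  using setting by (simp add: data_exchange_setting_def)

lemma I_finite: "finite I" and I_lits: "dom_of I \<subseteq> lits D" and I_no_nulls: "dom_of I \<inter> nulls D = {}"
  using valid dom by (auto simp: valid_instance_def source_instance_def nulls_def wf_domain_def)

lemma I_Src: "(R, as) \<in> I \<Longrightarrow> \<exists>r. R = Src r"
  using valid by (auto simp: valid_instance_def source_instance_def)

lemma iri_not_null: "p \<in> iris D \<Longrightarrow> p \<notin> nulls D"
  using dom by (auto simp: wf_domain_def nulls_def)

lemma delta_iri: "T \<in> shape_names S \<Longrightarrow> (p, U, \<mu>) \<in> delta S T \<Longrightarrow> p \<in> iris D"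
  and delta_shapes: "T \<in> shape_names S \<Longrightarrow> (p, U, \<mu>) \<in> delta S T \<Longrightarrow> U \<in> shapes S"
  and delta_unique: "T \<in> shape_names S \<Longrightarrow> (p, U, \<mu>) \<in> delta S T \<Longrightarrow> (p, U', \<mu>') \<in> delta S T \<Longrightarrow>
    U = U'"
  using schema unfolding wf_shex_def by blast+

definition role0 :: "'v \<Rightarrow> 't shape" where
  "role0 x = (if \<exists>f\<in>funs E. x \<in> fun_range E f \<and> (\<exists>T. used_with_type E f T)
     then Ty (SOME T. \<exists>f\<in>funs E. x \<in> fun_range E f \<and> used_with_type E f T) else LitShape)"

lemma role0_fun:
  assumes f: "f \<in> funs E" "x \<in> fun_range E f" "used_with_type E f T"
  shows "role0 x = Ty T"
proof -
  have "T' = T" if "g \<in> funs E" "x \<in> fun_range E g" "used_with_type E g T'" for g T'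
  proof -
    have "g = f" using that f setting by (fastforce simp: data_exchange_setting_def)
    then show ?thesis using that f typed by (auto simp: fully_typed_def)
  qed
  then have "(SOME T. \<exists>f\<in>funs E. x \<in> fun_range E f \<and> used_with_type E f T) = T"
    using f by (intro some_equality) blast+
  moreover have "\<exists>f\<in>funs E. x \<in> fun_range E f \<and> (\<exists>T. used_with_type E f T)"
    using f by blast
  ultimately show ?thesis by (simp add: role0_def)
qed

lemma role0_lit: "x \<in> lits D \<Longrightarrow> role0 x = LitShape"
  using setting dom by (force simp: role0_def data_exchange_setting_def wf_domain_def)

text \<open>A superset of the non-null values that can occur in a chase state.\<close>

definition constants :: "'v set" where
  "constants = dom_of I \<union>
     (\<Union>f\<in>funs E. F f ` {as. set as \<subseteq> dom_of I \<and> length as = fun_arity E f}) \<union>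
     (\<Union>T\<in>shape_names S. fst ` delta S T)"

lemma finite_constants: "finite constants"
  unfolding constants_def
  using setting schema finite_dom_of[OF I_finite]
  by (auto simp: data_exchange_setting_def wf_shex_def finite_lists_length_eq)

lemma constants_not_null: "x \<in> constants \<Longrightarrow> x \<notin> nulls D"
proof -
  have "F f as \<in> iris D" if "f \<in> funs E" "length as = fun_arity E f" for f as
    using that setting by (auto simp: data_exchange_setting_def fun_range_def)
  then show "x \<in> constants \<Longrightarrow> x \<notin> nulls D"
    using I_no_nulls iri_not_null delta_iri unfolding constants_def by force
qed

definition is_node :: "('r, 't, 'v) struct \<Rightarrow> 'v \<Rightarrow> bool" where
  "is_node K n \<longleftrightarrow> (\<exists>x p y. (Triple, [x, p, y]) \<in> K \<and> (n = x \<or> n = y))"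

text \<open>Every value has a single shape \<open>\<rho>\<close>, which is determined by the value unless it is a blank
  node; the shape of a blank node is chosen when a chase step creates it.\<close>

definition typed_state :: "('v \<Rightarrow> 't shape) \<Rightarrow> ('r, 't, 'v) struct \<Rightarrow> bool" where
  "typed_state \<rho> K \<longleftrightarrow> finite K \<and> I \<subseteq> K \<and> (\<forall>x. x \<notin> blanks D \<longrightarrow> \<rho> x = role0 x) \<and>
    (\<forall>R as. (R, as) \<in> K \<longrightarrow> (R, as) \<in> I \<or>
      (\<exists>x p y T \<mu>. R = Triple \<and> as = [x, p, y] \<and> T \<in> shape_names S \<and> \<rho> x = Ty T \<and>
        (p, \<rho> y, \<mu>) \<in> delta S T) \<or>
      (\<exists>n. R = Shape (\<rho> n) \<and> as = [n] \<and> \<rho> n \<in> shapes S \<and> is_node K n))"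

lemma typed_state_intro:
  assumes "finite K" "I \<subseteq> K" "\<And>x. x \<notin> blanks D \<Longrightarrow> \<rho> x = role0 x"
    and "\<And>R as. (R, as) \<in> K \<Longrightarrow> (R, as) \<notin> I \<Longrightarrow>
      (\<exists>x p y T \<mu>. R = Triple \<and> as = [x, p, y] \<and> T \<in> shape_names S \<and> \<rho> x = Ty T \<and>
        (p, \<rho> y, \<mu>) \<in> delta S T) \<or>
      (\<exists>n. R = Shape (\<rho> n) \<and> as = [n] \<and> \<rho> n \<in> shapes S \<and> is_node K n)"
  shows "typed_state \<rho> K"
  using assms unfolding typed_state_def by blast

lemma typed_state_fact_cases:
  assumes "typed_state \<rho> K" "(R, as) \<in> K"
  obtains "(R, as) \<in> I"
  | x p y T \<mu> where "R = Triple" "as = [x, p, y]" "T \<in> shape_names S" "\<rho> x = Ty T"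
      "(p, \<rho> y, \<mu>) \<in> delta S T"
  | n where "R = Shape (\<rho> n)" "as = [n]" "\<rho> n \<in> shapes S" "is_node K n"
  using assms unfolding typed_state_def by metis

lemma typed_state_finite: "typed_state \<rho> K \<Longrightarrow> finite K" and typed_state_I: "typed_state \<rho> K \<Longrightarrow> I \<subseteq> K"
  and typed_state_role0: "typed_state \<rho> K \<Longrightarrow> x \<notin> blanks D \<Longrightarrow> \<rho> x = role0 x"
  by (auto simp: typed_state_def)

lemma typed_state_Triple:
  assumes "typed_state \<rho> K" "(Triple, [x, p, y]) \<in> K"
  obtains T \<mu> where "T \<in> shape_names S" "\<rho> x = Ty T" "(p, \<rho> y, \<mu>) \<in> delta S T"
  using assms by (cases rule: typed_state_fact_cases) (auto dest: I_Src)

lemma typed_state_Shape: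
  assumes "typed_state \<rho> K" "(Shape U, [x]) \<in> K"
  shows "\<rho> x = U" "U \<in> shapes S" "is_node K x"
  using assms by (cases rule: typed_state_fact_cases; auto dest: I_Src)+

lemma typed_state_Src: "typed_state \<rho> K \<Longrightarrow> (Src r, as) \<in> K \<Longrightarrow> (Src r, as) \<in> I"
  by (erule (1) typed_state_fact_cases) auto

lemma typed_state_Triple_shape:
  assumes "typed_state \<rho> K" "(Triple, [x, p, y]) \<in> K" "(Shape (Ty T), [x]) \<in> K"
    "T \<in> shape_names S" "(p, U, \<mu>) \<in> delta S T"
  shows "\<rho> y = U"
proof -
  obtain T' \<mu>' where "T' \<in> shape_names S" "\<rho> x = Ty T'" "(p, \<rho> y, \<mu>') \<in> delta S T'"
    using typed_state_Triple[OF assms(1,2)] .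
  with assms delta_unique[of T] typed_state_Shape(1)[OF assms(1,3)] show ?thesis by auto
qed

lemma typed_state_initial: "typed_state role0 I"
  by (rule typed_state_intro) (auto simp: I_finite)

lemma st_tgd_head:
  assumes d: "Tgd \<phi> \<psi> \<in> st_tgds E" and g: "body_hom g \<phi> I"
  obtains s p t T U \<mu> where
    "head_facts F g \<psi> = {(Triple, [s, p, t]), (Shape (Ty T), [s]), (Shape U, [t])}"
    "s \<in> constants" "p \<in> constants" "t \<in> constants"
    "role0 s = Ty T" "role0 t = U" "T \<in> shape_names S" "(p, U, \<mu>) \<in> delta S T"
proof -
  note shape = typed[unfolded fully_typed_def, THEN conjunct1, rule_format, OF d]
  from shape obtain s p t T U \<mu> where st:
    "\<psi> = [(Triple, [s, Base (Const p), t]), (Shape (Ty T), [s]), (Shape U, [t])]"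
    "constructor_term E \<phi> s" "T \<in> shape_names S"
    "constructor_term E \<phi> t \<and> (\<exists>To\<in>shape_names (target E). U = Ty To) \<or>
         (\<exists>z\<in>body_vars \<phi>. t = Base (Var z) \<and> U = LitShape)"
    "(p, U, \<mu>) \<in> delta S T"
    by auto
  have constr: "eval_trm F g u \<in> constants \<and> role0 (eval_trm F g u) = Ty T'"
    if "constructor_term E \<phi> u" "(Shape (Ty T'), [u]) \<in> set \<psi>" for u T'
  proof -
    from that(1) obtain f ys where f: "f \<in> funs E" "length ys = fun_arity E f"
      "set ys \<subseteq> body_vars \<phi>" "u = App f (map Var ys)" by (auto simp: constructor_term_def)
    have e: "eval_trm F g u = F f (map g ys)" by (simp add: f(4) comp_def)
    have "set (map g ys) \<subseteq> dom_of I" using body_hom_vars_in_dom[OF g] f(3) by auto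
    then have "eval_trm F g u \<in> constants"
      unfolding e constants_def using f(1,2) by fastforce
    moreover have "used_with_type E f T'"
      unfolding used_with_type_def using d that(2) f(4) by blast
    ultimately show ?thesis
      using role0_fun[of f "eval_trm F g u"] f(1,2) unfolding e fun_range_def by auto
  qed
  have t: "eval_trm F g t \<in> constants \<and> role0 (eval_trm F g t) = U"
    using st(4)
  proof
    assume "\<exists>z\<in>body_vars \<phi>. t = Base (Var z) \<and> U = LitShape"
    then obtain z where z: "z \<in> body_vars \<phi>" "t = Base (Var z)" "U = LitShape" by auto
    with body_hom_vars_in_dom[OF g z(1)] show ?thesis
      using I_lits role0_lit by (auto simp: constants_def)
  qed (use constr st(1) in auto)
  have p: "p \<in> constants" using st(3,5) by (force simp: constants_def)
  have s: "eval_trm F g s \<in> constants \<and> role0 (eval_trm F g s) = Ty T"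
    using constr[of s T] st(1,2) by simp
  have h: "head_facts F g \<psi> = {(Triple, [eval_trm F g s, p, eval_trm F g t]),
      (Shape (Ty T), [eval_trm F g s]), (Shape U, [eval_trm F g t])}"
    by (simp add: head_facts_def st(1))
  show ?thesis
    using that[OF h] s p t st(3,5) by blast
qed

lemma st_tgd_body_source:
  assumes "typed_state \<rho> K" "Tgd \<phi> \<psi> \<in> st_tgds E" "body_hom g \<phi> K"
  shows "body_hom g \<phi> I"
proof -
  have "wf_st_tgd E (Tgd \<phi> \<psi>)" using assms(2) setting by (auto simp: data_exchange_setting_def)
  then have "\<forall>(R, bs)\<in>set \<phi>. \<exists>r. R = Src r" by (fastforce simp: wf_st_tgd_def)
  then show ?thesis using assms(3) typed_state_Src[OF assms(1)] by (fastforce simp: body_hom_def)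
qed

lemma egd_of_schema:
  assumes "Egd \<phi> x x' \<in> \<Sigma>"
  obtains T p U \<mu> where "T \<in> shape_names S" "(p, U, \<mu>) \<in> delta S T" "\<mu> \<in> {MOne, MOpt}"
    "(Egd \<phi> x x' :: ('r, 't, 'f, 'v) dep) = mult_le1_egd T p"
proof -
  have "Egd \<phi> x x' \<notin> st_tgds E"
    using typed by (auto simp: fully_typed_def)
  with assms show ?thesis
    using that by (simp add: setting_deps_def shex_deps_def typing_tgd_def mult_ge1_tgd_def) blast
qed

lemma chase_step_cases:
  assumes K: "typed_state \<rho> K" and step: "chase_step D F \<Sigma> K s"
  obtains
    (st) \<phi> \<psi> g where "Tgd \<phi> \<psi> \<in> st_tgds E" "body_hom g \<phi> I" "\<not> head_facts F g \<psi> \<subseteq> K"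
      "s = Some (K \<union> head_facts F g \<psi>)"
  | (typing) T p U \<mu> x y where "T \<in> shape_names S" "(p, U, \<mu>) \<in> delta S T"
      "(Shape (Ty T), [x]) \<in> K" "(Triple, [x, p, y]) \<in> K" "(Shape U, [y]) \<notin> K"
      "s = Some (insert (Shape U, [y]) K)"
  | (mult) T p U \<mu> x v where "T \<in> shape_names S" "(p, U, \<mu>) \<in> delta S T" "\<mu> \<in> {MOne, MPlus}"
      "(Shape (Ty T), [x]) \<in> K" "\<And>y. (Triple, [x, p, y]) \<notin> K" "v \<in> null_kind D U" "v \<notin> dom_of K"
      "s = Some (insert (Triple, [x, p, v]) K)"
  | (egd) T p U \<mu> x y z where "T \<in> shape_names S" "(p, U, \<mu>) \<in> delta S T" "\<mu> \<in> {MOne, MOpt}"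
      "(Shape (Ty T), [x]) \<in> K" "(Triple, [x, p, y]) \<in> K" "(Triple, [x, p, z]) \<in> K" "y \<noteq> z"
      "y \<in> nulls D \<and> s = Some (replace y z K) \<or> y \<notin> nulls D \<and> z \<notin> nulls D \<and> s = None"
  using step
proof (cases rule: chase_step.cases)
  case (tgd \<phi> \<psi> h)
  show ?thesis
  proof (cases "Tgd \<phi> \<psi> \<in> st_tgds E")
    case True
    then show ?thesis
      using st[of \<phi> \<psi> h] tgd st_tgd_body_source[OF K True, of h] by (auto simp: applicable_def)
  next
    case False
    with tgd(2) obtain T p U \<mu> where d: "T \<in> shape_names S" "(p, U, \<mu>) \<in> delta S T"
      "Tgd \<phi> \<psi> = typing_tgd T p U"
      by (auto simp: setting_deps_def shex_deps_def mult_ge1_tgd_def mult_le1_egd_def)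
    show ?thesis
      using typing[OF d(1,2), of "h 0" "h 1"] tgd(1,3) unfolding d(3)
      using d(3) by (auto simp: applicable_def typing_tgd_def body_hom_def head_facts_def)
  qed
next
  case (ex_tgd \<phi> y U \<psi> h v)
  have "ExTgd \<phi> y U \<psi> \<notin> st_tgds E"
    using typed by (auto simp: fully_typed_def)
  with ex_tgd(2) obtain T p U' \<mu> where d: "T \<in> shape_names S" "(p, U', \<mu>) \<in> delta S T"
    "\<mu> \<in> {MOne, MPlus}" "ExTgd \<phi> y U \<psi> = mult_ge1_tgd T p U'"
    by (auto simp: setting_deps_def shex_deps_def typing_tgd_def mult_le1_egd_def)
  show ?thesis
    using mult[OF d(1-3), of "h 0" v] ex_tgd(1,3,4) d(4)
    by (auto simp: applicable_def mult_ge1_tgd_def body_hom_def head_facts_def)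
next
  case (egd_left \<phi> x x' h)
  from egd_of_schema[OF egd_left(2)] obtain T p U \<mu> where d: "T \<in> shape_names S"
    "(p, U, \<mu>) \<in> delta S T" "\<mu> \<in> {MOne, MOpt}" 
    "(Egd \<phi> x x' :: ('r, 't, 'f, 'v) dep) = mult_le1_egd T p" .
  show ?thesis
    using egd[OF d(1-3), of "h 0" "h 1" "h 2"] egd_left(1,3,4) d(4)
    by (auto simp: applicable_def mult_le1_egd_def body_hom_def)
next
  case (egd_right \<phi> x x' h)
  from egd_of_schema[OF egd_right(2)] obtain T p U \<mu> where d: "T \<in> shape_names S"
    "(p, U, \<mu>) \<in> delta S T" "\<mu> \<in> {MOne, MOpt}" 
    "(Egd \<phi> x x' :: ('r, 't, 'f, 'v) dep) = mult_le1_egd T p" .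
  show ?thesis
    using egd[OF d(1-3), of "h 0" "h 2" "h 1"] egd_right(1,3,4) d(4)
    by (auto simp: applicable_def mult_le1_egd_def body_hom_def)
next
  case (egd_fail \<phi> x x' h)
  from egd_of_schema[OF egd_fail(2)] obtain T p U \<mu> where d: "T \<in> shape_names S"
    "(p, U, \<mu>) \<in> delta S T" "\<mu> \<in> {MOne, MOpt}" 
    "(Egd \<phi> x x' :: ('r, 't, 'f, 'v) dep) = mult_le1_egd T p" .
  show ?thesis
    using egd[OF d(1-3), of "h 0" "h 1" "h 2"] egd_fail(1,3-5) d(4)
    by (auto simp: applicable_def mult_le1_egd_def body_hom_def)
qed


lemma is_node_mono: "is_node K n \<Longrightarrow> K \<subseteq> L \<Longrightarrow> is_node L n"
  unfolding is_node_def by blast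

lemma typed_state_st:
  assumes K: "typed_state \<rho> K" and d: "Tgd \<phi> \<psi> \<in> st_tgds E" "body_hom g \<phi> I"
  shows "typed_state \<rho> (K \<union> head_facts F g \<psi>)" "dom_of (head_facts F g \<psi>) \<subseteq> constants"
proof -
  obtain s p t T U \<mu> where h:
    "head_facts F g \<psi> = {(Triple, [s, p, t]), (Shape (Ty T), [s]), (Shape U, [t])}"
    "s \<in> constants" "p \<in> constants" "t \<in> constants"
    "role0 s = Ty T" "role0 t = U" "T \<in> shape_names S" "(p, U, \<mu>) \<in> delta S T"
    using st_tgd_head[OF d] .
  have role: "\<rho> s = Ty T" "\<rho> t = U"
    using constants_not_null[OF h(2)] constants_not_null[OF h(4)] typed_state_role0[OF K] h(5,6)
    by (auto simp: nulls_def)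
  have nodes: "is_node (K \<union> head_facts F g \<psi>) s" "is_node (K \<union> head_facts F g \<psi>) t"
    unfolding is_node_def h(1) by blast+
  have shapes: "Ty T \<in> shapes S" "U \<in> shapes S"
    using h(7,8) delta_shapes by (auto simp: shapes_def)
  show "typed_state \<rho> (K \<union> head_facts F g \<psi>)"
  proof (rule typed_state_intro)
    fix R as assume *: "(R, as) \<in> K \<union> head_facts F g \<psi>" "(R, as) \<notin> I"
    show "(\<exists>x p y T \<mu>. R = Triple \<and> as = [x, p, y] \<and> T \<in> shape_names S \<and> \<rho> x = Ty T \<and>
        (p, \<rho> y, \<mu>) \<in> delta S T) \<or>
      (\<exists>n. R = Shape (\<rho> n) \<and> as = [n] \<and> \<rho> n \<in> shapes S \<and> is_node (K \<union> head_facts F g \<psi>) n)"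
    proof (cases "(R, as) \<in> K")
      case True
      with K show ?thesis
        by (cases rule: typed_state_fact_cases) (use *(2) is_node_mono in blast)+
    next
      case False
      then have "(R, as) \<in> {(Triple, [s, p, t]), (Shape (Ty T), [s]), (Shape U, [t])}"
        using *(1) h(1) by blast
      then show ?thesis
        using role nodes shapes h(7,8) by auto
    qed
  qed (use typed_state_finite[OF K] typed_state_I[OF K] typed_state_role0[OF K] in \<open>auto simp: h(1)\<close>)
  show "dom_of (head_facts F g \<psi>) \<subseteq> constants"
    using h(2-4) by (simp add: h(1))
qed

lemma typed_state_typing:
  assumes K: "typed_state \<rho> K" and "T \<in> shape_names S" "(p, U, \<mu>) \<in> delta S T"
    "(Shape (Ty T), [x]) \<in> K" "(Triple, [x, p, y]) \<in> K"
  shows "typed_state \<rho> (insert (Shape U, [y]) K)"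
proof (rule typed_state_intro)
  have y: "\<rho> y = U" using typed_state_Triple_shape assms by blast
  have n: "is_node (insert (Shape U, [y]) K) y"
    using assms(5) unfolding is_node_def by blast
  fix R as assume *: "(R, as) \<in> insert (Shape U, [y]) K" "(R, as) \<notin> I"
  show "(\<exists>x p y T \<mu>. R = Triple \<and> as = [x, p, y] \<and> T \<in> shape_names S \<and> \<rho> x = Ty T \<and>
      (p, \<rho> y, \<mu>) \<in> delta S T) \<or>
    (\<exists>n. R = Shape (\<rho> n) \<and> as = [n] \<and> \<rho> n \<in> shapes S \<and> is_node (insert (Shape U, [y]) K) n)"
  proof (cases "(R, as) \<in> K")
    case True
    with K show ?thesis
      by (cases rule: typed_state_fact_cases) (use *(2) is_node_mono in blast)+
  next
    case False
    then show ?thesis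
      using *(1) y n delta_shapes[OF assms(2,3)] by auto
  qed
qed (use typed_state_finite[OF K] typed_state_I[OF K] typed_state_role0[OF K] in auto)

lemma typed_state_mult:
  assumes K: "typed_state \<rho> K" and "T \<in> shape_names S" "(p, U, \<mu>) \<in> delta S T"
    "(Shape (Ty T), [x]) \<in> K" and v: "v \<in> null_kind D U" "v \<notin> dom_of K"
  shows "typed_state (\<rho>(v := U)) (insert (Triple, [x, p, v]) K)" (is "typed_state ?\<rho> ?K")
proof (rule typed_state_intro)
  fix z assume z: "z \<notin> blanks D"
  show "?\<rho> z = role0 z"
  proof (cases "z = v")
    case True
    with z v(1) have "U = LitShape" by (cases U) auto
    moreover from this have "v \<in> lits D" using v(1) dom by (auto simp: wf_domain_def)
    ultimately show ?thesis using True role0_lit by simp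
  qed (use typed_state_role0[OF K] z in simp)
next
  have x: "x \<noteq> v" "\<rho> x = Ty T"
    using v(2) assms(4) in_dom_ofI typed_state_Shape(1)[OF K assms(4)] by fastforce+
  fix R as assume *: "(R, as) \<in> ?K" "(R, as) \<notin> I"
  show "(\<exists>x p y T \<mu>. R = Triple \<and> as = [x, p, y] \<and> T \<in> shape_names S \<and> ?\<rho> x = Ty T \<and>
      (p, ?\<rho> y, \<mu>) \<in> delta S T) \<or>
    (\<exists>n. R = Shape (?\<rho> n) \<and> as = [n] \<and> ?\<rho> n \<in> shapes S \<and> is_node ?K n)"
  proof (cases "(R, as) \<in> K")
    case True
    have fresh: "v \<notin> set as" using v(2) in_dom_ofI[OF True] by blast
    from K True show ?thesis
    proof (cases rule: typed_state_fact_cases)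
      case (2 x p y T \<mu>)
      then show ?thesis using fresh by auto
    next
      case (3 n)
      then have "is_node ?K n" using is_node_mono by blast
      then show ?thesis using 3 fresh by auto
    qed (use *(2) in blast)
  next
    case False
    then show ?thesis
      using *(1) x assms(2,3) by auto
  qed
qed (use typed_state_finite[OF K] typed_state_I[OF K] in auto)

lemma map_replace_non_null:
  "a \<in> nulls D \<Longrightarrow> set as \<inter> nulls D = {} \<Longrightarrow> map (\<lambda>c. if c = a then b else c) as = as"
  by (rule map_idI) auto

lemma replace_Triple:
  assumes "typed_state \<rho> K" "a \<in> nulls D" "(Triple, [x, p, y]) \<in> K"
  shows "(Triple, [if x = a then b else x, p, if y = a then b else y]) \<in> replace a b K"
proof -
  obtain T \<mu> where "T \<in> shape_names S" "(p, \<rho> y, \<mu>) \<in> delta S T"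
    using typed_state_Triple[OF assms(1,3)] .
  then have "p \<noteq> a" using delta_iri iri_not_null assms(2) by blast
  then show ?thesis unfolding replace_def by (intro image_eqI[OF _ assms(3)]) simp
qed

lemma typed_state_replace:
  assumes K: "typed_state \<rho> K" and a: "a \<in> nulls D" and ab: "\<rho> a = \<rho> b"
  shows "typed_state \<rho> (replace a b K)" (is "typed_state \<rho> ?K")
proof (rule typed_state_intro)
  let ?f = "\<lambda>c. if c = a then b else c"
  have I: "map ?f as = as" if "(R, as) \<in> I" for R as
    using that I_no_nulls in_dom_ofI by (intro map_replace_non_null[OF a]) fastforce
  show "I \<subseteq> ?K"
  proof
    fix e assume "e \<in> I"
    then obtain R as where e: "e = (R, as)" "(R, as) \<in> I" by (cases e) auto
    then show "e \<in> ?K"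
      unfolding replace_def using I[OF e(2)] typed_state_I[OF K] by (intro image_eqI[of _ _ "(R, as)"]) auto
  qed
  have role: "\<rho> (?f c) = \<rho> c" for c using ab by simp
  fix R as assume *: "(R, as) \<in> ?K" "(R, as) \<notin> I"
  then obtain bs where bs: "(R, bs) \<in> K" "as = map ?f bs"
    by (auto simp: replace_def)
  from K bs(1) show "(\<exists>x p y T \<mu>. R = Triple \<and> as = [x, p, y] \<and> T \<in> shape_names S \<and> \<rho> x = Ty T \<and>
      (p, \<rho> y, \<mu>) \<in> delta S T) \<or>
    (\<exists>n. R = Shape (\<rho> n) \<and> as = [n] \<and> \<rho> n \<in> shapes S \<and> is_node ?K n)"
  proof (cases rule: typed_state_fact_cases)
    case 1
    then show ?thesis using I bs(2) *(2) by simp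
  next
    case (2 x p y T \<mu>)
    then have "p \<noteq> a" using delta_iri iri_not_null a by blast
    then have "as = [?f x, p, ?f y]" using bs(2) 2(2) by simp
    then show ?thesis using 2 role by metis
  next
    case (3 n)
    from 3(4) obtain x p y where t: "(Triple, [x, p, y]) \<in> K" "n = x \<or> n = y"
      unfolding is_node_def by blast
    have "is_node ?K (?f n)"
      unfolding is_node_def using replace_Triple[OF K a t(1), of b] t(2) by blast
    moreover have "as = [?f n]" using bs(2) 3(2) by simp
    moreover have "\<rho> (?f n) = \<rho> n" using role .
    ultimately show ?thesis using 3(1,3) by (intro disjI2 exI[of _ "?f n"]) simp
  qed
qed (use typed_state_finite[OF K] typed_state_role0[OF K] in \<open>auto simp: replace_def\<close>)


section \<open>Termination\<close>

definition vals :: "('r, 't, 'v) struct \<Rightarrow> 'v set" where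
  "vals K = constants \<union> dom_of K"

definition open_constraints ::
  "('v \<Rightarrow> 't shape) \<Rightarrow> ('r, 't, 'v) struct \<Rightarrow> ('v \<times> 'v \<times> 't shape) set" where
  "open_constraints \<rho> K = {(x, p, U). x \<in> vals K \<and> (p, U) \<in> strong_constraints S (\<rho> x) \<and>
     (\<forall>y. (Triple, [x, p, y]) \<notin> K)}"

definition open_weight :: "('v \<Rightarrow> 't shape) \<Rightarrow> ('r, 't, 'v) struct \<Rightarrow> nat" where
  "open_weight \<rho> K = (\<Sum>(x, p, U)\<in>open_constraints \<rho> K. shape_weight S U)"

definition possible_facts :: "'v set \<Rightarrow> ('r, 't, 'v) struct" where
  "possible_facts V = I \<union> insert Triple (Shape ` shapes S) \<times> {as. set as \<subseteq> V \<and> length as \<le> 3}"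

text \<open>A tgd adds facts over the present values, an egd removes a value and opens no constraint, and
  an existential step closes a constraint of larger weight than all those it opens.\<close>

definition chase_measure :: "('v \<Rightarrow> 't shape) \<Rightarrow> ('r, 't, 'v) struct \<Rightarrow> nat \<times> nat \<times> nat" where
  "chase_measure \<rho> K =
     (open_weight \<rho> K, card (vals K), card (possible_facts (vals K) - K))"

abbreviation lex3 :: "((nat \<times> nat \<times> nat) \<times> (nat \<times> nat \<times> nat)) set" where
  "lex3 \<equiv> less_than <*lex*> less_than <*lex*> less_than"

lemma finite_vals: "typed_state \<rho> K \<Longrightarrow> finite (vals K)"
  using finite_constants finite_dom_of[OF typed_state_finite] by (simp add: vals_def)

lemma finite_possible_facts: "finite V \<Longrightarrow> finite (possible_facts V)"
  using I_finite schema
  by (auto simp: possible_facts_def shapes_def wf_shex_def finite_lists_length_le)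

lemma subset_possible_facts:
  assumes "typed_state \<rho> K"
  shows "K \<subseteq> possible_facts (vals K)"
proof
  fix e assume "e \<in> K"
  then obtain R as where e: "e = (R, as)" "(R, as) \<in> K" by (cases e) auto
  have "set as \<subseteq> vals K" using in_dom_ofI[OF e(2)] by (auto simp: vals_def)
  with assms e(2) show "e \<in> possible_facts (vals K)"
    unfolding e(1) by (cases rule: typed_state_fact_cases) (auto simp: possible_facts_def)
qed

lemma finite_open_constraints:
  assumes "typed_state \<rho> K"
  shows "finite (open_constraints \<rho> K)"
proof -
  have "open_constraints \<rho> K \<subseteq> Sigma (vals K) (\<lambda>x. strong_constraints S (\<rho> x))"
    by (auto simp: open_constraints_def)
  then show ?thesis
    using finite_vals[OF assms] finite_strong_constraints[OF schema]
    by (auto intro: finite_subset[OF _ finite_SigmaI])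
qed

lemma open_weight_mono:
  assumes "typed_state \<rho> K" "open_constraints \<rho>' K' \<subseteq> open_constraints \<rho> K"
  shows "open_weight \<rho>' K' \<le> open_weight \<rho> K"
  unfolding open_weight_def by (intro sum_mono2 finite_open_constraints assms) auto

lemma measure_tgd:
  assumes K: "typed_state \<rho> K" and L: "typed_state \<rho> L" and "K \<subset> L" "vals L = vals K"
  shows "(chase_measure \<rho> L, chase_measure \<rho> K) \<in> lex3"
proof -
  have "open_weight \<rho> L \<le> open_weight \<rho> K"
    using assms(3,4) by (intro open_weight_mono[OF K]) (auto simp: open_constraints_def)
  moreover have "possible_facts (vals K) - L \<subset> possible_facts (vals K) - K"
    using subset_possible_facts[OF L] assms(3,4) by auto
  then have "card (possible_facts (vals K) - L) < card (possible_facts (vals K) - K)"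
    using finite_possible_facts[OF finite_vals[OF K]] by (intro psubset_card_mono) auto
  ultimately show ?thesis using assms(4) by (auto simp: chase_measure_def)
qed

lemma measure_egd:
  assumes K: "typed_state \<rho> K" and a: "a \<in> nulls D" "a \<in> dom_of K" "b \<in> dom_of K" "a \<noteq> b"
  shows "(chase_measure \<rho> (replace a b K), chase_measure \<rho> K) \<in> lex3"
proof -
  let ?K = "replace a b K"
  have sub: "vals ?K \<subseteq> vals K - {a}"
    using a constants_not_null by (auto simp: vals_def dom_of_replace)
  have "open_weight \<rho> ?K \<le> open_weight \<rho> K"
  proof (intro open_weight_mono[OF K] subsetI)
    fix e assume e: "e \<in> open_constraints \<rho> ?K"
    obtain x p U where [simp]: "e = (x, p, U)" by (cases e)
    have "x \<noteq> a" "x \<in> vals K" using e sub by (auto simp: open_constraints_def)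
    moreover have "(Triple, [x, p, y]) \<notin> K" for y
      using replace_Triple[OF K a(1), of x p y b] e \<open>x \<noteq> a\<close> by (auto simp: open_constraints_def)
    ultimately show "e \<in> open_constraints \<rho> K" using e by (auto simp: open_constraints_def)
  qed
  moreover have "vals ?K \<subset> vals K" using sub a(2) by (auto simp: vals_def)
  then have "card (vals ?K) < card (vals K)" by (intro psubset_card_mono finite_vals[OF K])
  ultimately show ?thesis by (auto simp: chase_measure_def)
qed

lemma measure_mult:
  assumes K: "typed_state \<rho> K" and c: "T \<in> shape_names S" "(p, U, \<mu>) \<in> delta S T" "\<mu> \<in> {MOne, MPlus}"
    and x: "(Shape (Ty T), [x]) \<in> K" "\<And>y. (Triple, [x, p, y]) \<notin> K"
    and v: "v \<in> null_kind D U" "v \<notin> dom_of K"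
  shows "(chase_measure (\<rho>(v := U)) (insert (Triple, [x, p, v]) K), chase_measure \<rho> K) \<in> lex3"
    (is "(chase_measure ?\<rho> ?K, _) \<in> _")
proof -
  let ?new = "Pair v ` strong_constraints S U"
  let ?w = "\<lambda>(x :: 'v, p :: 'v, U). shape_weight S U"
  have "v \<in> nulls D" using v(1) by (cases U) (auto simp: nulls_def)
  then have fresh: "v \<notin> vals K" using v(2) constants_not_null by (auto simp: vals_def)
  have "p \<in> constants" using c(1,2) by (force simp: constants_def)
  moreover have xd: "x \<in> vals K" using in_dom_ofI[OF x(1)] by (simp add: vals_def)
  ultimately have vals: "vals ?K = insert v (vals K)" by (auto simp: vals_def)
  have role: "\<rho> x = Ty T" using typed_state_Shape(1)[OF K x(1)] .
  then have xo: "(x, p, U) \<in> open_constraints \<rho> K"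
    using xd x(2) c by (auto simp: open_constraints_def strong_constraints_def)
  have sub: "open_constraints ?\<rho> ?K \<subseteq> (open_constraints \<rho> K - {(x, p, U)}) \<union> ?new"
  proof
    fix e assume e: "e \<in> open_constraints ?\<rho> ?K"
    obtain x' p' U' where [simp]: "e = (x', p', U')" by (cases e)
    show "e \<in> (open_constraints \<rho> K - {(x, p, U)}) \<union> ?new"
    proof (cases "x' = v")
      case False
      with e show ?thesis by (auto simp: open_constraints_def vals)
    qed (use e in \<open>auto simp: open_constraints_def\<close>)
  qed
  have fin: "finite (open_constraints \<rho> K)" "finite ?new"
    using finite_open_constraints[OF K] finite_strong_constraints[OF schema] by auto
  have "open_weight ?\<rho> ?K \<le> sum ?w ((open_constraints \<rho> K - {(x, p, U)}) \<union> ?new)"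
    unfolding open_weight_def using fin by (intro sum_mono2 sub) auto
  also have "\<dots> \<le> sum ?w (open_constraints \<rho> K - {(x, p, U)}) + sum ?w ?new"
    using fin by (simp add: sum_Un_nat)
  also have "sum ?w ?new = (\<Sum>(p, U')\<in>strong_constraints S U. shape_weight S U')"
    by (subst sum.reindex) (auto simp: inj_on_def intro!: sum.cong)
  also have "sum ?w (open_constraints \<rho> K - {(x, p, U)}) + \<dots>
      < sum ?w (open_constraints \<rho> K - {(x, p, U)}) + shape_weight S U"
    using sum_strong_constraints_less_weight[OF schema weak] by simp
  also have "\<dots> = open_weight \<rho> K"
    unfolding open_weight_def using sum.remove[OF fin(1) xo, of ?w] by simp
  finally show ?thesis unfolding chase_measure_def in_lex_prod less_than_iff by blast
qed

lemma chase_step_decreases: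
  assumes K: "typed_state \<rho> K" and step: "chase_step D F \<Sigma> K (Some K')"
  shows "\<exists>\<rho>'. typed_state \<rho>' K' \<and> (chase_measure \<rho>' K', chase_measure \<rho> K) \<in> lex3"
  using K step
proof (cases rule: chase_step_cases)
  case (st \<phi> \<psi> g)
  note new = typed_state_st[OF K st(1,2)]
  have "(chase_measure \<rho> (K \<union> head_facts F g \<psi>), chase_measure \<rho> K) \<in> lex3"
    using st(3) new by (intro measure_tgd K) (auto simp: vals_def)
  then show ?thesis using st(4) new(1) by auto
next
  case (typing T p U \<mu> x y)
  note new = typed_state_typing[OF K typing(1-4)]
  have "y \<in> dom_of K" using in_dom_ofI[OF typing(4)] by simp
  then have "(chase_measure \<rho> (insert (Shape U, [y]) K), chase_measure \<rho> K) \<in> lex3"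
    using typing(5) new by (intro measure_tgd K) (auto simp: vals_def)
  then show ?thesis using typing(6) new by auto
next
  case (mult T p U \<mu> x v)
  from mult(8) show ?thesis
    using typed_state_mult[OF K mult(1,2,4,6,7)] measure_mult[OF K mult(1-7)] by auto
next
  case (egd T p U \<mu> x y z)
  have "\<rho> y = \<rho> z"
    using typed_state_Triple_shape[OF K egd(5,4,1,2)] typed_state_Triple_shape[OF K egd(6,4,1,2)] by simp
  moreover have "y \<in> dom_of K" "z \<in> dom_of K"
    using in_dom_ofI[OF egd(5)] in_dom_ofI[OF egd(6)] by auto
  ultimately show ?thesis
    using egd(7,8) typed_state_replace[OF K] measure_egd[OF K] by blast
qed

lemma no_infinite_chase:
  assumes "typed_state \<rho> K" "\<sigma> 0 = Some K"
    and "\<And>i. \<exists>K. \<sigma> i = Some K \<and> chase_step D F \<Sigma> K (\<sigma> (Suc i))"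
  shows False
proof -
  have "wf lex3" by (intro wf_lex_prod wf_less_than)
  then show False
    using assms
  proof (induction "chase_measure \<rho> K" arbitrary: \<rho> K \<sigma> rule: wf_induct_rule)
    case less
    from less.prems(3)[of 1] obtain K' where K': "\<sigma> 1 = Some K'" by auto
    with less.prems(2) less.prems(3)[of 0] have "chase_step D F \<Sigma> K (Some K')" by auto
    then obtain \<rho>' where "typed_state \<rho>' K'" "(chase_measure \<rho>' K', chase_measure \<rho> K) \<in> lex3"
      using chase_step_decreases[OF less.prems(1)] by blast
    then show False
      using less.hyps[of \<rho>' K' "\<lambda>i. \<sigma> (Suc i)"] K' less.prems(3) by simp
  qed
qed

lemma chase_sequence_finite: "chase_sequence D F \<Sigma> I N \<sigma> \<Longrightarrow> N \<noteq> \<infinity>"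
  using no_infinite_chase[OF typed_state_initial, of \<sigma>] by (cases N) (auto simp: chase_sequence_def)

lemma chase_sequence_inv:
  assumes "chase_sequence D F \<Sigma> I N \<sigma>" "enat i \<le> N" "\<sigma> i = Some K"
  shows "\<exists>\<rho>. typed_state \<rho> K"
  using assms(2,3)
proof (induction i arbitrary: K)
  case 0
  then show ?case using assms(1) typed_state_initial by (auto simp: chase_sequence_def)
next
  case (Suc i)
  then have "enat i < N" by (simp add: Suc_ile_eq)
  with assms(1) obtain L where L: "\<sigma> i = Some L" "chase_step D F \<Sigma> L (Some K)"
    using Suc.prems(2) unfolding chase_sequence_def by metis
  with Suc.IH \<open>enat i < N\<close> obtain \<rho> where "typed_state \<rho> L" by fastforce
  then show ?case using chase_step_decreases L(2) by blast
qed


section \<open>Universality\<close>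

definition maps_into ::
  "('v \<Rightarrow> 'v) \<Rightarrow> ('r, 't, 'v) struct \<Rightarrow> ('r, 't, 'v) struct \<Rightarrow> bool" where
  "maps_into h K M \<longleftrightarrow>
     (\<forall>a. a \<notin> nulls D \<longrightarrow> h a = a) \<and> (\<forall>R as. (R, as) \<in> K \<longrightarrow> (R, map h as) \<in> M)"

lemma typing_in_deps: "T \<in> shape_names S \<Longrightarrow> (p, U, \<mu>) \<in> delta S T \<Longrightarrow> typing_tgd T p U \<in> \<Sigma>"
  and mult_in_deps: "T \<in> shape_names S \<Longrightarrow> (p, U, \<mu>) \<in> delta S T \<Longrightarrow> \<mu> \<in> {MOne, MPlus} \<Longrightarrow>
    mult_ge1_tgd T p U \<in> \<Sigma>"
  and egd_in_deps: "T \<in> shape_names S \<Longrightarrow> (p, U, \<mu>) \<in> delta S T \<Longrightarrow> \<mu> \<in> {MOne, MOpt} \<Longrightarrow>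
    mult_le1_egd T p \<in> \<Sigma>"
  unfolding setting_deps_def shex_deps_def by blast+

lemma chase_step_maps_into:
  assumes K: "typed_state \<rho> K" and step: "chase_step D F \<Sigma> K s" and h: "maps_into h K M"
    and M: "I \<subseteq> M" "\<And>d. d \<in> \<Sigma> \<Longrightarrow> sat_dep F M d"
  shows "\<exists>K' h'. s = Some K' \<and> maps_into h' K' M"
proof -
  have fixed: "h a = a" if "a \<notin> nulls D" for a using that h by (simp add: maps_into_def)
  have hK: "(R, map h as) \<in> M" if "(R, as) \<in> K" for R as using that h by (simp add: maps_into_def)
  have hT: "(Triple, [h x, p, h y]) \<in> M"
    if "(Triple, [x, p, y]) \<in> K" "T \<in> shape_names S" "(p, U, \<mu>) \<in> delta S T" for x p y T U \<mu>
    using hK[OF that(1)] fixed[of p] iri_not_null[OF delta_iri[OF that(2,3)]] by simp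
  have hS: "(Shape U, [h x]) \<in> M" if "(Shape U, [x]) \<in> K" for x U
    using hK[OF that] by simp
  from K step show ?thesis
  proof (cases rule: chase_step_cases)
    case (st \<phi> \<psi> g)
    have "sat_dep F M (Tgd \<phi> \<psi>)" using M(2) st(1) by (simp add: setting_deps_def)
    then have sub: "head_facts F g \<psi> \<subseteq> M"
      using body_hom_mono[OF st(2) M(1)] by (simp add: sat_dep_def)
    have "map h as = as" if "(R, as) \<in> head_facts F g \<psi>" for R as
      using typed_state_st(2)[OF K st(1,2)] in_dom_ofI[OF that] constants_not_null fixed
      by (intro map_idI) blast
    then have "maps_into h (K \<union> head_facts F g \<psi>) M"
      using h sub unfolding maps_into_def by (metis Un_iff subsetD)
    then show ?thesis using st(4) by blast
  next
    case (typing T p U \<mu> x y)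
    have "sat_dep F M (typing_tgd T p U)" using M(2) typing_in_deps typing(1,2) by blast
    then have "(Shape U, [h y]) \<in> M"
      using hS[OF typing(3)] hT[OF typing(4,1,2)] unfolding sat_typing_tgd by blast
    then have "maps_into h (insert (Shape U, [y]) K) M"
      using h by (auto simp: maps_into_def)
    then show ?thesis using typing(6) by blast
  next
    case (mult T p U \<mu> x v)
    have "sat_dep F M (mult_ge1_tgd T p U)" using M(2) mult_in_deps mult(1-3) by blast
    then obtain w where w: "(Triple, [h x, p, w]) \<in> M"
      using hS[OF mult(4)] unfolding sat_mult_ge1_tgd by blast
    have "v \<in> nulls D" using mult(6) by (cases U) (auto simp: nulls_def)
    have "p \<notin> nulls D" using iri_not_null[OF delta_iri[OF mult(1,2)]] .
    have "x \<noteq> v" using mult(7) in_dom_ofI[OF mult(4)] by auto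
    have "(R, map (h(v := w)) as) \<in> M" if "(R, as) \<in> K" for R as
    proof -
      have "map (h(v := w)) as = map h as"
        using mult(7) in_dom_ofI[OF that] by (intro map_cong) auto
      then show ?thesis using hK[OF that] by (simp only:)
    qed
    then have "maps_into (h(v := w)) (insert (Triple, [x, p, v]) K) M"
      using w fixed \<open>v \<in> nulls D\<close> \<open>p \<notin> nulls D\<close> \<open>x \<noteq> v\<close> by (auto simp: maps_into_def)
    then show ?thesis using mult(8) by blast
  next
    case (egd T p U \<mu> x y z)
    have "sat_dep F M (mult_le1_egd T p)" using M(2) egd_in_deps egd(1-3) by blast
    then have yz: "h y = h z"
      using hS[OF egd(4)] hT[OF egd(5,1,2)] hT[OF egd(6,1,2)] unfolding sat_mult_le1_egd by blast
    have "y \<in> nulls D \<or> z \<in> nulls D" using yz fixed egd(7) by metis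
    then have s: "s = Some (replace y z K)" using egd(8) by blast
    have "map h (map (\<lambda>c. if c = y then z else c) as) = map h as" for as
      using yz by simp
    then have "maps_into h (replace y z K) M"
      using h unfolding maps_into_def replace_def by (auto simp del: map_map)
    then show ?thesis using s by blast
  qed
qed

lemma restrict_target_facts:
  assumes "typed_state \<rho> K"
  shows "(R, as) \<in> restrict_target S K \<longleftrightarrow> (R, as) \<in> K \<and> (\<forall>r. R \<noteq> Src r)"
proof -
  have "R \<in> insert Triple (Shape ` shapes S)" if "(R, as) \<in> K" "\<forall>r. R \<noteq> Src r"
    using assms that(1) by (cases rule: typed_state_fact_cases) (use that(2) I_Src in blast)+
  then show ?thesis by (auto simp: restrict_target_def)
qed

lemma shex_deps_cases:
  assumes "d \<in> shex_deps S"
  obtains T p U \<mu> where "T \<in> shape_names S" "(p, U, \<mu>) \<in> delta S T" "d = typing_tgd T p U"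
  | T p U \<mu> where "T \<in> shape_names S" "(p, U, \<mu>) \<in> delta S T" "\<mu> \<in> {MOne, MPlus}"
      "d = mult_ge1_tgd T p U"
  | T p U \<mu> where "T \<in> shape_names S" "(p, U, \<mu>) \<in> delta S T" "\<mu> \<in> {MOne, MOpt}"
      "d = mult_le1_egd T p"
  using assms unfolding shex_deps_def by blast

lemma shex_deps_target_only:
  assumes d: "d \<in> shex_deps S"
    and K: "\<And>R as. (\<forall>r. R \<noteq> Src r) \<Longrightarrow> (R, as) \<in> K \<longleftrightarrow> (R, as) \<in> J"
  shows "sat_dep F K d \<longleftrightarrow> sat_dep F J d"
proof -
  have K': "(Triple, as) \<in> K \<longleftrightarrow> (Triple, as) \<in> J" "(Shape U, as) \<in> K \<longleftrightarrow> (Shape U, as) \<in> J" for U as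
    by (rule K, simp)+
  show ?thesis
    using d by (cases rule: shex_deps_cases)
      (simp_all only: sat_typing_tgd sat_mult_ge1_tgd sat_mult_le1_egd K')
qed

lemma solution_sat_deps:
  assumes "solution D E I J" "d \<in> \<Sigma>"
  shows "sat_dep F (I \<union> J) d"
proof (cases "d \<in> st_tgds E")
  case True
  then show ?thesis using assms(1) by (simp add: solution_def)
next
  case False
  then have d: "d \<in> shex_deps S" using assms(2) by (simp add: setting_deps_def)
  have "sat_dep F (I \<union> J) d \<longleftrightarrow> sat_dep F J d"
    using I_Src by (intro shex_deps_target_only[OF d]) fastforce
  then show ?thesis using assms(1) d by (simp add: solution_def)
qed

lemma chase_sequence_maps_into:
  assumes "chase_sequence D F \<Sigma> I N \<sigma>" and J: "solution D E I J" and "enat i \<le> N"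
  shows "\<exists>K h. \<sigma> i = Some K \<and> maps_into h K (I \<union> J)"
  using assms(3)
proof (induction i)
  case 0
  have "maps_into (\<lambda>a. a) I (I \<union> J)" by (simp add: maps_into_def)
  then show ?case using assms(1) by (auto simp: chase_sequence_def)
next
  case (Suc i)
  then have i: "enat i < N" by (simp add: Suc_ile_eq)
  from Suc.IH[OF less_imp_le[OF i]] obtain K h where
    K: "\<sigma> i = Some K" "maps_into h K (I \<union> J)" by blast
  have "chase_step D F \<Sigma> K (\<sigma> (Suc i))"
    using assms(1) i K(1) unfolding chase_sequence_def by fastforce
  moreover obtain \<rho> where "typed_state \<rho> K"
    using chase_sequence_inv[OF assms(1) _ K(1)] i by fastforce
  ultimately show ?case
    using chase_step_maps_into[of \<rho> K _ h "I \<union> J"] K(2) solution_sat_deps[OF J] by blast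
qed

lemma restrict_target_typed_graph:
  assumes K: "typed_state \<rho> K"
  shows "typed_graph D S (restrict_target S K)"
proof -
  define G where "G = {(s, p, t). (Triple, [s, p, t]) \<in> K}"
  define ty where "ty n = {U. (Shape U, [n]) \<in> K}" for n
  have "rdf_graph D G"
    unfolding rdf_graph_def
  proof
    fix e assume "e \<in> G"
    then obtain s p t where e: "e = (s, p, t)" "(Triple, [s, p, t]) \<in> K" by (auto simp: G_def)
    obtain T \<mu> where T: "T \<in> shape_names S" "\<rho> s = Ty T" "(p, \<rho> t, \<mu>) \<in> delta S T"
      using typed_state_Triple[OF K e(2)] .
    have "s \<notin> lits D"
    proof
      assume s: "s \<in> lits D"
      then have "s \<notin> blanks D" using dom by (auto simp: wf_domain_def)
      then show False using typed_state_role0[OF K] role0_lit[OF s] T(2) by simp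
    qed
    then show "e \<in> (iris D \<union> blanks D) \<times> iris D \<times> (iris D \<union> blanks D \<union> lits D)"
      using delta_iri[OF T(1,3)] dom e(1) by (auto simp: wf_domain_def)
  qed
  moreover have "\<forall>n\<in>nodes G. ty n \<subseteq> shapes S"
    using typed_state_Shape(2)[OF K] by (auto simp: ty_def)
  moreover have "restrict_target S K = graph_struct G ty"
  proof (rule set_eqI)
    fix e :: "('r, 't) sym \<times> 'v list"
    obtain R as where e: "e = (R, as)" by (cases e)
    have "(R, as) \<in> graph_struct G ty" if "(R, as) \<in> K" "\<forall>r. R \<noteq> Src r"
      using K that(1)
    proof (cases rule: typed_state_fact_cases)
      case 1
      then show ?thesis using that(2) I_Src by blast
    next
      case (2 x p y T \<mu>)
      then show ?thesis using that(1) by (auto simp: graph_struct_def G_def)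
    next
      case (3 n)
      then have "n \<in> nodes G" by (auto simp: nodes_def G_def is_node_def)
      then show ?thesis using that(1) 3(1,2) by (auto simp: graph_struct_def ty_def)
    qed
    moreover have "(R, as) \<in> K \<and> (\<forall>r. R \<noteq> Src r)" if "(R, as) \<in> graph_struct G ty"
      using that by (auto simp: graph_struct_def G_def ty_def)
    ultimately show "e \<in> restrict_target S K \<longleftrightarrow> e \<in> graph_struct G ty"
      unfolding e restrict_target_facts[OF K] by blast
  qed
  ultimately show ?thesis unfolding typed_graph_def by blast
qed

lemma final_state_solution:
  assumes K: "typed_state \<rho> K" and final: "final_state F \<Sigma> (Some K)"
  shows "solution D E I (restrict_target S K)"
proof -
  have sat: "sat_dep F K d" if "d \<in> \<Sigma>" for d
    using final that unfolding final_state_def not_applicable_iff_sat_dep[symmetric] by blast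
  have "I \<union> restrict_target S K = K"
  proof (rule set_eqI)
    fix e :: "('r, 't) sym \<times> 'v list"
    obtain R as where e: "e = (R, as)" by (cases e)
    show "e \<in> I \<union> restrict_target S K \<longleftrightarrow> e \<in> K"
      unfolding e Un_iff restrict_target_facts[OF K] using typed_state_I[OF K] typed_state_Src[OF K] by blast
  qed
  moreover have "sat_dep F (restrict_target S K) d" if d: "d \<in> shex_deps S" for d
  proof -
    have "sat_dep F (restrict_target S K) d \<longleftrightarrow> sat_dep F K d"
      by (intro shex_deps_target_only[OF d]) (simp add: restrict_target_facts[OF K])
    then show ?thesis using sat d by (simp add: setting_deps_def)
  qed
  ultimately show ?thesis
    using sat restrict_target_typed_graph[OF K] by (simp add: solution_def setting_deps_def)
qed

lemma maps_into_homomorphism: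
  assumes K: "typed_state \<rho> K" and h: "maps_into h K (I \<union> J)" and J: "typed_graph D S J"
  shows "homomorphism D (restrict_target S K) J h"
proof -
  have facts: "(R, map h as) \<in> J" if "(R, as) \<in> restrict_target S K" for R as
  proof -
    have "(R, as) \<in> K" "\<forall>r. R \<noteq> Src r" using that restrict_target_facts[OF K] by auto
    then show ?thesis using h I_Src unfolding maps_into_def by blast
  qed
  have "h a \<in> dom_of J" if "a \<in> dom_of (restrict_target S K)" for a
  proof -
    obtain R as where "(R, as) \<in> restrict_target S K" "a \<in> set as"
      using \<open>a \<in> dom_of (restrict_target S K)\<close> by (auto simp: dom_of_def)
    then show ?thesis using in_dom_ofI[OF facts, of R as "h a"] by simp
  qed
  then show ?thesis
    using facts h by (auto simp: homomorphism_def maps_into_def)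
qed

lemma successful_chase_universal:
  assumes seq: "maximal_chase_sequence D F \<Sigma> I (enat n) \<sigma>" and K: "\<sigma> n = Some K"
  shows "universal_solution D E I (restrict_target S K)"
proof -
  have chase: "chase_sequence D F \<Sigma> I (enat n) \<sigma>" and "final_state F \<Sigma> (Some K)"
    using seq K by (auto simp: maximal_chase_sequence_def)
  moreover obtain \<rho> where \<rho>: "typed_state \<rho> K" using chase_sequence_inv[OF chase _ K] by auto
  ultimately have "solution D E I (restrict_target S K)" using final_state_solution by blast
  moreover have "\<exists>h. homomorphism D (restrict_target S K) J h" if J: "solution D E I J" for J
  proof -
    obtain h where "maps_into h K (I \<union> J)"
      using chase_sequence_maps_into[OF chase J, of n] K by auto
    then show ?thesis
      using maps_into_homomorphism[OF \<rho>] J unfolding solution_def by blast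
  qed
  ultimately show ?thesis by (simp add: universal_solution_def)
qed

lemma failing_chase_no_solution:
  assumes "chase_sequence D F \<Sigma> I N \<sigma>" "chase_fails N \<sigma>"
  shows "\<not> solution D E I J"
  using chase_sequence_maps_into[OF assms(1)] assms(2) by (fastforce simp: chase_fails_def)

lemma maximal_chase_cases:
  assumes "maximal_chase_sequence D F \<Sigma> I N \<sigma>"
  shows "chase_fails N \<sigma> \<or> (\<exists>J. chase_computes S N \<sigma> J \<and> universal_solution D E I J)"
proof -
  obtain n where n: "N = enat n"
    using chase_sequence_finite[of N \<sigma>] assms by (cases N) (auto simp: maximal_chase_sequence_def)
  show ?thesis
  proof (cases "\<sigma> n")
    case None
    then show ?thesis using n by (auto simp: chase_fails_def)
  next
    case (Some K)
    then show ?thesis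
      using successful_chase_universal[of n \<sigma> K] assms n by (auto simp: chase_computes_def)
  qed
qed

end


theorem proposition1:
  fixes D :: "'v rdf_domain"
    and E :: "('r, 't, 'f, 'v) setting"
    and I :: "('r, 't, 'v) struct"
  assumes "wf_domain D"
    and "data_exchange_setting D E"
    and "fully_typed D E"
    and "valid_instance D (source E) I"
    and "weakly_recursive (target E)"
  shows "(\<forall>N \<sigma>. chase_sequence D (fun_int E) (setting_deps E) I N \<sigma> \<longrightarrow> N \<noteq> \<infinity>) \<and>
    ((\<forall>N \<sigma>. maximal_chase_sequence D (fun_int E) (setting_deps E) I N \<sigma> \<longrightarrow>
        chase_fails N \<sigma>) \<or>
     (\<forall>N \<sigma>. maximal_chase_sequence D (fun_int E) (setting_deps E) I N \<sigma> \<longrightarrow>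
        (\<exists>J. chase_computes (target E) N \<sigma> J \<and> universal_solution D E I J)))"
proof -
  interpret weakly_recursive_setting D E I
    using assms by unfold_locales
  show ?thesis
  proof (intro conjI allI impI)
    fix N \<sigma> assume "chase_sequence D (fun_int E) (setting_deps E) I N \<sigma>"
    then show "N \<noteq> \<infinity>" by (rule chase_sequence_finite)
  next
    show "(\<forall>N \<sigma>. maximal_chase_sequence D (fun_int E) (setting_deps E) I N \<sigma> \<longrightarrow>
        chase_fails N \<sigma>) \<or>
     (\<forall>N \<sigma>. maximal_chase_sequence D (fun_int E) (setting_deps E) I N \<sigma> \<longrightarrow>
        (\<exists>J. chase_computes (target E) N \<sigma> J \<and> universal_solution D E I J))"
    proof (cases "\<exists>J. solution D E I J")
      case True
      then have "\<not> chase_fails N \<sigma>"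
        if "maximal_chase_sequence D (fun_int E) (setting_deps E) I N \<sigma>" for N \<sigma>
        using that failing_chase_no_solution by (auto simp: maximal_chase_sequence_def)
      then show ?thesis using maximal_chase_cases by blast
    next
      case False
      then show ?thesis using maximal_chase_cases by (auto simp: universal_solution_def)
    qed
  qed
qed

end
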